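(* There exists a constant $c>0$ such that for every even positive integer $n$ the following holds: if $M^<$ is an ordered matching on $n$ vertices with $\chi_<(M^<)=2$ chosen uniformly at random among all such ordered matchings, then with high probability (i.e., with probability tending to $1$ as $n\to\infty$) \[ r_<(M^<,K_3^<) \geq c\left(\frac{n}{\log n}\right)^{5/4}. \]
   Context: An ordered graph $G^<$ is a graph together with a linear ordering of its vertex set. An ordered graph $G^<$ is an ordered subgraph of $H^<$ if $G$ is a subgraph of $H$ and the vertex ordering of $G$ is the restriction of that of $H$; equivalently, $H^<$ contains a copy of $G^<$ via an order-preserving injective map of vertices sending edges to edges. An ordered matching is a $1$-regular ordered graph. $K_N^<$ denotes the complete graph on $[N]=\{1,\dots,N\}$ with the natural order. The ordered Ramsey number $r_<(G^<,H^<)$ is the smallest positive integer $N$ such that every red-blue coloring of the edges of $K_N^<$ contains a red copy of $G^<$ (an ordered subgraph isomorphic to $G^<$ as ordered graphs, all of whose edges are red) or a blue copy of $H^<$. The interval chromatic number $\chi_<(G^<)$ is the minimum number of intervals (sets of consecutive vertices in the ordering) into which the vertex set can be partitioned so that no edge has both endpoints in the same interval. All logarithms are base 2. *)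

theory Defs
  imports "HOL-Probability.Probability_Mass_Function" "HOL-Library.Disjoint_Sets"
begin

(* The vertex ordering is the one inherited from the linearly ordered vertex type. *)
datatype 'a ograph = OGraph (verts: "'a set") (edges: "'a set set")

definition ordered_graph :: "'a::linorder ograph \<Rightarrow> bool" where
  "ordered_graph G \<longleftrightarrow>
     finite (verts G) \<and> (\<forall>e\<in>edges G. e \<subseteq> verts G \<and> card e = 2)"

definition complete_ograph :: "nat \<Rightarrow> nat ograph" where
  "complete_ograph N = OGraph {1..N} {e. e \<subseteq> {1..N} \<and> card e = 2}"

definition contains_copy :: "'b::linorder ograph \<Rightarrow> 'a::linorder ograph \<Rightarrow> bool" where
  "contains_copy H G \<longleftrightarrow>
     (\<exists>f. strict_mono_on (verts G) f \<and> f ` verts G \<subseteq> verts H \<and>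
          (\<forall>e\<in>edges G. f ` e \<in> edges H))"

definition ordered_matching :: "'a::linorder ograph \<Rightarrow> bool" where
  "ordered_matching M \<longleftrightarrow>
     ordered_graph M \<and> (\<forall>v\<in>verts M. card {e \<in> edges M. v \<in> e} = 1)"

definition interval_of :: "'a::linorder set \<Rightarrow> 'a set \<Rightarrow> bool" where
  "interval_of V I \<longleftrightarrow>
     I \<subseteq> V \<and> (\<forall>x\<in>I. \<forall>y\<in>I. \<forall>z\<in>V. x \<le> z \<and> z \<le> y \<longrightarrow> z \<in> I)"

definition interval_chromatic_number :: "'a::linorder ograph \<Rightarrow> nat" where
  "interval_chromatic_number G =
     (LEAST k. \<exists>P. partition_on (verts G) P \<and> card P = k \<and>
        (\<forall>I\<in>P. interval_of (verts G) I \<and> (\<forall>e\<in>edges G. \<not> e \<subseteq> I)))"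

datatype colour = Red | Blue

definition colour_class :: "nat \<Rightarrow> (nat set \<Rightarrow> colour) \<Rightarrow> colour \<Rightarrow> nat ograph" where
  "colour_class N col k =
     OGraph (verts (complete_ograph N)) {e \<in> edges (complete_ograph N). col e = k}"

(* For finite G and H some such N exists by Ramsey's theorem, so LEAST is meaningful. *)
definition ordered_ramsey :: "'a::linorder ograph \<Rightarrow> 'b::linorder ograph \<Rightarrow> nat" where
  "ordered_ramsey G H =
     (LEAST N. 0 < N \<and>
        (\<forall>col. contains_copy (colour_class N col Red) G \<or>
               contains_copy (colour_class N col Blue) H))"

(* Every isomorphism type of ordered graphs on n vertices has exactly one
   representative with vertex set {1..n}. The set below is finite, and it is
   nonempty for even n > 0, as pmf_of_set requires. *)
definition matchings_chi2 :: "nat \<Rightarrow> nat ograph set" where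
  "matchings_chi2 n =
     {M. ordered_matching M \<and> verts M = {1..n} \<and> interval_chromatic_number M = 2}"

definition random_matching_chi2 :: "nat \<Rightarrow> nat ograph pmf" where
  "random_matching_chi2 n = pmf_of_set (matchings_chi2 n)"

end

theory Submission
  imports Defs "HOL-Library.Ramsey" "HOL-Combinatorics.Transposition" "HOL-Real_Asymp.Real_Asymp"
begin

text \<open>Blow up a triangle-free graph \<open>H\<close> on \<open>r\<close> vertices: cut \<open>[r t]\<close> into \<open>r\<close> consecutive blocks of
  length \<open>t\<close> and colour a pair blue iff its two blocks are adjacent in \<open>H\<close>, so that there is no blue
  triangle. Write \<open>n = 2 k\<close>. With high probability any two intervals of length about
  \<open>sqrt (k log k)\<close>, one in each half of the vertex set of \<open>M\<close>, are joined by an edge of \<open>M\<close>. In a red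
  copy of \<open>M\<close>, the blocks receiving many vertices of the left half must therefore be nonadjacent in
  \<open>H\<close> to those receiving many vertices of the right half. With \<open>r\<close> about \<open>sqrt (k / log k)\<close> the sparse
  blocks hold at most half of the vertices of each half, so there are at least \<open>k / (2 t)\<close> dense blocks
  on either side. This is impossible if any two disjoint sets of about \<open>sqrt r log r\<close> vertices
  of \<open>H\<close> are joined by an edge and \<open>t\<close> is about \<open>(k / log k) powr (3/4)\<close>. Such an \<open>H\<close> arises from the random graph
  with edge probability \<open>1 / (4 sqrt r)\<close> by deleting a maximal family of edge-disjoint triangles.\<close>

subsection \<open>Triangle-free graphs without bipartite holes\<close>

text \<open>The union bound, for nonnegative weights so that it applies to \<open>wt\<close>
  directly.\<close>

lemma sum_UN_le:
  fixes f :: "'b \<Rightarrow> real"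
  assumes "finite I" "\<And>i. i \<in> I \<Longrightarrow> finite (A i)" "\<And>x. 0 \<le> f x"
  shows "sum f (\<Union>i\<in>I. A i) \<le> (\<Sum>i\<in>I. sum f (A i))"
  using assms(1,2)
proof (induction I rule: finite_induct)
  case (insert i I)
  have "sum f (A i \<union> (\<Union>i\<in>I. A i)) \<le> sum f (A i) + sum f (\<Union>i\<in>I. A i)"
    using insert.prems insert.hyps assms(3) by (subst sum.union_inter[symmetric]) (auto intro!: sum_nonneg)
  with insert show ?case by (auto intro: order_trans)
qed simp

text \<open>\<open>wt p E G\<close> is the probability that the binomial random subset of \<open>E\<close> equals \<open>G\<close>.\<close>
definition wt :: "real \<Rightarrow> 'a set \<Rightarrow> 'a set \<Rightarrow> real" where
  "wt p E G = p ^ card G * (1 - p) ^ card (E - G)"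

lemma wt_nonneg: "0 \<le> p \<Longrightarrow> p \<le> 1 \<Longrightarrow> 0 \<le> wt p E G"
  by (simp add: wt_def)

text \<open>Elements are included independently, so requiring \<open>S\<close> and forbidding
  \<open>U\<close> costs one factor per element of these sets. The proof expands a product of
  two-term sums over the subsets of \<open>E\<close>.\<close>

lemma sum_wt_between:
  assumes fin: "finite E" and S: "S \<subseteq> E" and U: "U \<subseteq> E" and disj: "S \<inter> U = {}"
  shows "(\<Sum>G | G \<subseteq> E \<and> S \<subseteq> G \<and> G \<inter> U = {}. wt p E G) = p ^ card S * (1 - p) ^ card U"
proof -
  \<comment> \<open>The zeros remove from the expansion every subset that meets \<open>U\<close> or
    misses an element of \<open>S\<close>.\<close>
  let ?f = "\<lambda>e. if e \<in> U then 0 else p" and ?g = "\<lambda>e. if e \<in> S then 0 else 1 - p"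
  have "(\<Prod>e\<in>E. ?f e + ?g e) = (\<Sum>G\<in>Pow E. (\<Prod>e\<in>G. ?f e) * (\<Prod>e\<in>E-G. ?g e))"
    by (rule prod_add[OF fin])
  also have "\<dots> = (\<Sum>G | G \<subseteq> E \<and> S \<subseteq> G \<and> G \<inter> U = {}. wt p E G)"
  proof (rule sum.mono_neutral_cong_right)
    show "finite (Pow E)" using fin by simp
    show "{G. G \<subseteq> E \<and> S \<subseteq> G \<and> G \<inter> U = {}} \<subseteq> Pow E" by auto
    show "\<forall>G\<in>Pow E - {G. G \<subseteq> E \<and> S \<subseteq> G \<and> G \<inter> U = {}}. (\<Prod>e\<in>G. ?f e) * (\<Prod>e\<in>E-G. ?g e) = 0"
    proof
      fix G assume G: "G \<in> Pow E - {G. G \<subseteq> E \<and> S \<subseteq> G \<and> G \<inter> U = {}}"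
      then have fG: "finite G" "finite (E - G)" using fin finite_subset by auto
      from G consider e where "e \<in> G" "e \<in> U" | e where "e \<in> E - G" "e \<in> S" using S by auto
      then show "(\<Prod>e\<in>G. ?f e) * (\<Prod>e\<in>E-G. ?g e) = 0"
        by cases (use fG in \<open>auto intro!: prod_zero\<close>)
    qed
    show "(\<Prod>e\<in>G. ?f e) * (\<Prod>e\<in>E-G. ?g e) = wt p E G"
      if "G \<in> {G. G \<subseteq> E \<and> S \<subseteq> G \<and> G \<inter> U = {}}" for G
    proof -
      have "(\<Prod>e\<in>G. ?f e) = (\<Prod>e\<in>G. p)" using that by (intro prod.cong) auto
      moreover have "(\<Prod>e\<in>E-G. ?g e) = (\<Prod>e\<in>E-G. 1 - p)" using that by (intro prod.cong) auto
      ultimately show ?thesis by (simp add: wt_def)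
    qed
  qed
  finally have "(\<Sum>G | G \<subseteq> E \<and> S \<subseteq> G \<and> G \<inter> U = {}. wt p E G) = (\<Prod>e\<in>E. ?f e + ?g e)" ..
  also have "\<dots> = (\<Prod>e\<in>E. (if e \<in> S then p else 1) * (if e \<in> U then 1 - p else 1))"
    using disj by (intro prod.cong) auto
  also have "\<dots> = (\<Prod>e\<in>E. if e \<in> S then p else 1) * (\<Prod>e\<in>E. if e \<in> U then 1 - p else 1)"
    by (rule prod.distrib)
  also have "\<dots> = p ^ card S * (1 - p) ^ card U"
    using S U fin by (simp add: prod.If_cases Int_absorb1)
  finally show ?thesis .
qed

section \<open>Edges between two sets, and packings of triangles\<close>

definition cross :: "'a set \<Rightarrow> 'a set \<Rightarrow> 'a set set" where
  "cross A B = (\<lambda>(a, b). {a, b}) ` (A \<times> B)"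

lemma mem_cross_iff: "e \<in> cross A B \<longleftrightarrow> (\<exists>a\<in>A. \<exists>b\<in>B. e = {a, b})"
  by (auto simp: cross_def)

lemma card_cross:
  assumes "A \<inter> B = {}"
  shows "card (cross A B) = card A * card B"
proof -
  have "inj_on (\<lambda>(a, b). {a, b}) (A \<times> B)"
    using assms by (auto simp: inj_on_def doubleton_eq_iff)
  then show ?thesis by (simp add: cross_def card_image card_cartesian_product)
qed

lemma cross_subset_nsets: "A \<inter> B = {} \<Longrightarrow> A \<subseteq> V \<Longrightarrow> B \<subseteq> V \<Longrightarrow> cross A B \<subseteq> nsets V 2"
  by (auto simp: cross_def)

text \<open>Triangles are given by their vertex sets, and disjoint pair sets mean edge-disjoint
  triangles. Shared vertices are allowed.\<close>

definition packing :: "'a set set \<Rightarrow> bool" where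
  "packing T \<longleftrightarrow> pairwise (\<lambda>x y. nsets x 2 \<inter> nsets y 2 = {}) T"

abbreviation covered :: "'a set set \<Rightarrow> 'a set set" where
  "covered T \<equiv> \<Union>t\<in>T. nsets t 2"

lemma card_nsets: "finite A \<Longrightarrow> card (nsets A k) = card A choose k"
  using n_subsets[of A k] by (simp add: nsets_def) (metis (no_types, lifting) Collect_cong finite_subset)

lemma card_covered:
  assumes "packing T" "finite T" "T \<subseteq> nsets V 3"
  shows "card (covered T) = 3 * card T"
proof -
  have t: "finite t \<and> card t = 3" if "t \<in> T" for t using that assms by (auto simp: nsets_def)
  have "card (covered T) = (\<Sum>t\<in>T. card (nsets t 2))"
    using assms t by (intro card_UN_disjoint) (auto simp: packing_def pairwise_def finite_imp_finite_nsets)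
  also have "\<dots> = (\<Sum>t\<in>T. 3)"
    using t by (intro sum.cong) (auto simp: card_nsets choose_two)
  finally show ?thesis by simp
qed

definition touching :: "'a set \<Rightarrow> 'a set \<Rightarrow> 'a set \<Rightarrow> 'a set set" where
  "touching V A B = {t \<in> nsets V 3. nsets t 2 \<inter> cross A B \<noteq> {}}"

text \<open>An edge between \<open>A\<close> and \<open>B\<close> and a third vertex determine the
  triangle.\<close>

lemma card_touching:
  assumes "finite V" "A \<subseteq> V" "B \<subseteq> V"
  shows "card (touching V A B) \<le> card A * card B * card V"
proof -
  have "touching V A B \<subseteq> (\<lambda>(a, b, v). {a, b, v}) ` (A \<times> B \<times> V)"
  proof
    fix t assume "t \<in> touching V A B"
    then obtain a b where ab: "a \<in> A" "b \<in> B" "{a, b} \<in> nsets t 2" and t: "t \<subseteq> V" "card t = 3"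
      by (auto simp: touching_def cross_def nsets_def)
    have ft: "finite t" using t by (metis card.infinite zero_neq_numeral)
    have ne: "a \<noteq> b" "a \<in> t" "b \<in> t" using ab(3) by auto
    have "card (t - {a, b}) = 1" using ne t ft by (simp add: card_Diff_subset)
    then obtain v where "t - {a, b} = {v}" by (rule card_1_singletonE)
    then have "t = {a, b, v}" "v \<in> V" using ne t by auto
    then show "t \<in> (\<lambda>(a, b, v). {a, b, v}) ` (A \<times> B \<times> V)" using ab by force
  qed
  moreover have fin: "finite (A \<times> B \<times> V)" using assms finite_subset by blast
  ultimately have "card (touching V A B) \<le> card ((\<lambda>(a, b, v). {a, b, v}) ` (A \<times> B \<times> V))"
    by (intro card_mono) auto
  also have "\<dots> \<le> card (A \<times> B \<times> V)" by (rule card_image_le[OF fin])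
  finally show ?thesis by (simp add: card_cartesian_product mult.assoc)
qed

text \<open>A graph is bad for \<open>A, B\<close> if a packing of its triangles uses up all its edges between
  \<open>A\<close> and \<open>B\<close>; only the triangles of the packing having such an edge matter.\<close>
definition bad :: "'a set \<Rightarrow> 'a set \<Rightarrow> 'a set \<Rightarrow> 'a set set set" where
  "bad V A B = {G. G \<subseteq> nsets V 2 \<and>
     (\<exists>T \<subseteq> touching V A B. packing T \<and> covered T \<subseteq> G \<and> G \<inter> cross A B \<subseteq> covered T)}"

text \<open>For a fixed packing \<open>T\<close>, its \<open>3 * card T\<close> edges must be
  present and all cross pairs not covered by it absent. Summing over \<open>T\<close> multiplies the
  weight \<open>(1 - p) ^ (s * s)\<close> of an empty cross set by a factor that the bound on
  \<open>p\<close> keeps below the square root of its inverse.\<close>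

lemma sum_wt_bad:
  fixes p :: real
  assumes fin: "finite V" and p: "0 < p" "p \<le> 1/2" "16 * real (card V) * p\<^sup>2 \<le> 1"
    and A: "A \<subseteq> V" "card A = s" and B: "B \<subseteq> V" "card B = s" and disj: "A \<inter> B = {}"
  shows "(\<Sum>G\<in>bad V A B. wt p (nsets V 2) G) \<le> exp (- p * s\<^sup>2 / 2)"
proof -
  let ?E = "nsets V 2" and ?X = "cross A B" and ?R = "touching V A B"
  have fE: "finite ?E" using fin by (rule finite_imp_finite_nsets)
  have fR: "finite ?R" using fin by (simp add: touching_def finite_imp_finite_nsets)
  have XE: "?X \<subseteq> ?E" using cross_subset_nsets[OF disj A(1) B(1)] .
  have cX: "card ?X = s * s" using card_cross[OF disj] A B by simp
  define Q where "Q = {T \<in> Pow ?R. packing T}"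
  define F where "F = (\<lambda>T. {G. G \<subseteq> ?E \<and> covered T \<subseteq> G \<and> G \<inter> (?X - covered T) = {}})"
  have fQ: "finite Q" using fR by (simp add: Q_def)
  have fF: "finite (F T)" for T using fE by (auto simp: F_def)
  have sub: "bad V A B \<subseteq> (\<Union>T\<in>Q. F T)"
  proof
    fix G assume "G \<in> bad V A B"
    then obtain T where T: "G \<subseteq> ?E" "T \<subseteq> ?R" "packing T" "covered T \<subseteq> G" "G \<inter> ?X \<subseteq> covered T"
      unfolding bad_def mem_Collect_eq by - (elim conjE exE, rule that)
    have "G \<inter> (?X - covered T) = {}" using T(5) by (simp add: Int_Diff[symmetric])
    with T have "T \<in> Q" "G \<in> F T" by (simp_all only: Q_def F_def mem_Collect_eq Pow_iff simp_thms)
    then show "G \<in> (\<Union>T\<in>Q. F T)" by (rule UN_I)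
  qed
  have "(\<Sum>G\<in>bad V A B. wt p ?E G) \<le> (\<Sum>G\<in>(\<Union>T\<in>Q. F T). wt p ?E G)"
    using fQ fF p sub by (intro sum_mono2) (auto intro: wt_nonneg)
  also have "\<dots> \<le> (\<Sum>T\<in>Q. \<Sum>G\<in>F T. wt p ?E G)"
    using fQ fF p by (intro sum_UN_le) (auto intro: wt_nonneg)
  also have "\<dots> \<le> (\<Sum>T\<in>Q. (1 - p) ^ (s * s) * ((p / (1 - p)) ^ 3) ^ card T)"
  proof (rule sum_mono)
    fix T assume T: "T \<in> Q"
    then have TR: "T \<subseteq> ?R" and fT: "finite T" and pk: "packing T"
      using fR finite_subset by (auto simp: Q_def)
    have T3: "T \<subseteq> nsets V 3" using TR by (auto simp: touching_def)
    have cov: "covered T \<subseteq> ?E" using T3 by (fastforce simp: nsets_def)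
    have fcov: "finite (covered T)" using cov fE finite_subset by blast
    have cc: "card (covered T) = 3 * card T" by (rule card_covered[OF pk fT T3])
    have "(\<Sum>G\<in>F T. wt p ?E G) = p ^ card (covered T) * (1 - p) ^ card (?X - covered T)"
      unfolding F_def using fE cov XE by (intro sum_wt_between) auto
    also have "\<dots> \<le> p ^ (3 * card T) * ((1 - p) ^ (s * s) / (1 - p) ^ (3 * card T))"
    proof -
      \<comment> \<open>A covered pair need not lie in \<open>?X\<close>, so at most
        \<open>3 * card T\<close> of the \<open>s * s\<close> cross pairs are exempt from being
        absent.\<close>
      have "s * s \<le> card (?X - covered T) + 3 * card T"
        using diff_card_le_card_Diff[OF fcov, of ?X] cX cc by linarith
      then have "(1 - p) ^ (card (?X - covered T) + 3 * card T) \<le> (1 - p) ^ (s * s)"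
        using p by (intro power_decreasing) auto
      then have "(1 - p) ^ card (?X - covered T) \<le> (1 - p) ^ (s * s) / (1 - p) ^ (3 * card T)"
        using p by (simp add: power_add field_simps)
      then show ?thesis unfolding cc using p by (intro mult_left_mono) auto
    qed
    also have "\<dots> = (1 - p) ^ (s * s) * ((p / (1 - p)) ^ 3) ^ card T"
      by (simp add: power_divide flip: power_mult)
    finally show "(\<Sum>G\<in>F T. wt p ?E G) \<le> (1 - p) ^ (s * s) * ((p / (1 - p)) ^ 3) ^ card T" .
  qed
  \<comment> \<open>Dropping the packing condition only adds nonnegative terms, and the sum over all
    subsets of \<open>?R\<close> factors.\<close>
  also have "\<dots> \<le> (\<Sum>T\<in>Pow ?R. (1 - p) ^ (s * s) * ((p / (1 - p)) ^ 3) ^ card T)"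
    using fR p by (intro sum_mono2) (auto simp: Q_def)
  also have "\<dots> = (1 - p) ^ (s * s) * (1 + (p / (1 - p)) ^ 3) ^ card ?R"
    using prod_add[OF fR, of "\<lambda>_. (p / (1 - p)) ^ 3" "\<lambda>_. 1"]
    by (simp add: sum_distrib_left add.commute)
  also have "\<dots> \<le> exp (- p) ^ (s * s) * exp (8 * p ^ 3) ^ (s * s * card V)"
  proof (rule mult_mono)
    show "(1 - p) ^ (s * s) \<le> exp (- p) ^ (s * s)"
      using p exp_ge_add_one_self[of "-p"] by (intro power_mono) auto
    have "p / (1 - p) \<le> 2 * p" using p by (simp add: field_simps)
    then have "(p / (1 - p)) ^ 3 \<le> (2 * p) ^ 3" using p by (intro power_mono) auto
    then have "1 + (p / (1 - p)) ^ 3 \<le> 1 + 8 * p ^ 3" by (simp add: power_mult_distrib)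
    also have "\<dots> \<le> exp (8 * p ^ 3)" by (rule exp_ge_add_one_self)
    finally have *: "1 + (p / (1 - p)) ^ 3 \<le> exp (8 * p ^ 3)" .
    have "(1 + (p / (1 - p)) ^ 3) ^ card ?R \<le> exp (8 * p ^ 3) ^ card ?R"
      using * p by (intro power_mono) auto
    also have "\<dots> \<le> exp (8 * p ^ 3) ^ (s * s * card V)"
      using card_touching[OF fin A(1) B(1)] A B p by (intro power_increasing) auto
    finally show "(1 + (p / (1 - p)) ^ 3) ^ card ?R \<le> exp (8 * p ^ 3) ^ (s * s * card V)" .
  qed (use p in auto)
  also have "\<dots> = exp (p * real s ^ 2 * (8 * real (card V) * p\<^sup>2 - 1))"
  proof -
    have "exp (- p) ^ (s * s) = exp (real (s * s) * (- p))"
      "exp (8 * p ^ 3) ^ (s * s * card V) = exp (real (s * s * card V) * (8 * p ^ 3))"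
      by (simp_all only: exp_of_nat_mult)
    moreover have "real (s * s) * (- p) + real (s * s * card V) * (8 * p ^ 3)
        = p * real s ^ 2 * (8 * real (card V) * p\<^sup>2 - 1)"
      by (simp add: algebra_simps power2_eq_square power3_eq_cube)
    ultimately show ?thesis by (simp only: exp_add[symmetric])
  qed
  \<comment> \<open>The bound on \<open>p\<close> gives
    \<open>8 * real (card V) * p\<^sup>2 - 1 \<le> - 1 / 2\<close>: the choice of triangles costs at
    most half of the exponent.\<close>
  also have "\<dots> \<le> exp (p * real s ^ 2 * (- 1 / 2))"
    unfolding exp_le_cancel_iff using p by (intro mult_left_mono) auto
  finally show ?thesis by (simp add: algebra_simps)
qed

text \<open>There are at most \<open>card V ^ (2 * s)\<close> pairs of disjoint
  \<open>s\<close>-sets, so some graph is bad for none of them. Deleting a maximal packing of its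
  triangles destroys all triangles, and not being bad means that an edge survives between any two
  such sets.\<close>

lemma triangle_free_no_hole:
  fixes V :: "'a set" and p :: real
  assumes fin: "finite V" and p: "0 < p" "p \<le> 1/2" "16 * real (card V) * p\<^sup>2 \<le> 1"
    and small: "real (card V) ^ (2 * s) * exp (- p * s\<^sup>2 / 2) < 1"
  obtains H where "H \<subseteq> nsets V 2" "\<And>t. t \<in> nsets V 3 \<Longrightarrow> \<not> nsets t 2 \<subseteq> H"
    "\<And>A B. A \<subseteq> V \<Longrightarrow> B \<subseteq> V \<Longrightarrow> A \<inter> B = {} \<Longrightarrow> card A = s \<Longrightarrow> card B = s \<Longrightarrow> H \<inter> cross A B \<noteq> {}"
proof -
  let ?E = "nsets V 2"
  have fE: "finite ?E" using fin by (rule finite_imp_finite_nsets)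
  define Z where "Z = {(A, B). A \<in> nsets V s \<and> B \<in> nsets V s \<and> A \<inter> B = {}}"
  have Zsub: "Z \<subseteq> nsets V s \<times> nsets V s" by (auto simp: Z_def)
  have fZ: "finite Z" using Zsub fin by (meson finite_SigmaI finite_imp_finite_nsets finite_subset)
  have fbad: "finite (bad V A B)" for A B using fE by (auto simp: bad_def)
  have "\<exists>G. G \<subseteq> ?E \<and> G \<notin> (\<Union>z\<in>Z. bad V (fst z) (snd z))"
  proof (rule ccontr)
    assume "\<not> ?thesis"
    then have all: "Pow ?E \<subseteq> (\<Union>z\<in>Z. bad V (fst z) (snd z))" by (auto simp only: Pow_iff)
    \<comment> \<open>If every graph were bad for some pair, the total weight 1 would be at most the
      sum of all bad weights.\<close>
    have "1 = (\<Sum>G\<in>Pow ?E. wt p ?E G)"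
      using sum_wt_between[OF fE, of "{}" "{}" p] by (simp add: Pow_def)
    also have "\<dots> \<le> (\<Sum>G\<in>(\<Union>z\<in>Z. bad V (fst z) (snd z)). wt p ?E G)"
      using fZ fbad p all by (intro sum_mono2) (auto intro: wt_nonneg)
    also have "\<dots> \<le> (\<Sum>z\<in>Z. \<Sum>G\<in>bad V (fst z) (snd z). wt p ?E G)"
      using fZ fbad p by (intro sum_UN_le) (auto intro: wt_nonneg)
    also have "\<dots> \<le> (\<Sum>z\<in>Z. exp (- p * s\<^sup>2 / 2))"
      using p by (intro sum_mono sum_wt_bad[OF fin]) (auto simp: Z_def nsets_def)
    also have "\<dots> = real (card Z) * exp (- p * s\<^sup>2 / 2)" by simp
    also have "\<dots> \<le> real (card V) ^ (2 * s) * exp (- p * s\<^sup>2 / 2)"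
    proof (rule mult_right_mono)
      have "card Z \<le> card (nsets V s \<times> nsets V s)"
        using Zsub fin by (intro card_mono) (auto intro: finite_imp_finite_nsets)
      also have "\<dots> = (card V choose s) * (card V choose s)"
        using fin by (simp add: card_cartesian_product card_nsets)
      also have "\<dots> \<le> card V ^ s * card V ^ s"
      proof -
        have "card V choose s \<le> card V ^ s"
          by (cases "s \<le> card V") (auto intro: binomial_le_pow simp: binomial_eq_0)
        then show ?thesis by (intro mult_mono) auto
      qed
      also have "\<dots> = card V ^ (2 * s)" by (simp add: mult_2 power_add)
      finally show "real (card Z) \<le> real (card V) ^ (2 * s)" by (metis of_nat_mono of_nat_power)
    qed simp
    finally show False using small by simp
  qed
  then obtain G where G: "G \<subseteq> ?E" and good': "G \<notin> (\<Union>z\<in>Z. bad V (fst z) (snd z))"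
    by (elim exE conjE)
  have good: "G \<notin> bad V A B" if "(A, B) \<in> Z" for A B
    using good' UN_I[OF that, of G "\<lambda>z. bad V (fst z) (snd z)"] by auto
  define PP where "PP = {T. T \<subseteq> nsets V 3 \<and> packing T \<and> covered T \<subseteq> G}"
  have "finite PP" by (rule finite_subset[of _ "Pow (nsets V 3)"]) (auto simp: PP_def fin finite_imp_finite_nsets)
  moreover have "{} \<in> PP" by (simp add: PP_def packing_def)
  ultimately obtain T where T: "T \<in> PP" and max: "\<And>T'. T' \<in> PP \<Longrightarrow> T \<subseteq> T' \<Longrightarrow> T = T'"
    using finite_has_maximal[of PP] by auto
  show thesis
  proof (rule that)
    show "G - covered T \<subseteq> ?E" using G by auto
    show "\<not> nsets t 2 \<subseteq> G - covered T" if t: "t \<in> nsets V 3" for t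
    proof
      assume H: "nsets t 2 \<subseteq> G - covered T"
      have "card t = 3" using t by (simp add: nsets_def)
      then have "nsets t 2 \<noteq> {}" by (simp add: nsets_eq_empty_iff)
      then have "t \<notin> T" using H by auto
      \<comment> \<open>The pairs of \<open>t\<close> survive the deletion, so they are disjoint
        from those of every triangle in \<open>T\<close>.\<close>
      moreover have "packing (insert t T)"
        using T H by (auto simp: PP_def packing_def pairwise_insert)
      then have "insert t T \<in> PP" using T H t by (auto simp: PP_def)
      ultimately show False using max by blast
    qed
    show "(G - covered T) \<inter> cross A B \<noteq> {}"
      if AB: "A \<subseteq> V" "B \<subseteq> V" "A \<inter> B = {}" "card A = s" "card B = s" for A B
    proof
      assume e: "(G - covered T) \<inter> cross A B = {}"
      have "(A, B) \<in> Z" using AB fin finite_subset by (auto simp: Z_def nsets_def)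
      then have "G \<notin> bad V A B" by (rule good)
      moreover have "G \<in> bad V A B"
        unfolding bad_def mem_Collect_eq
      proof (intro conjI exI)
        show "T \<inter> touching V A B \<subseteq> touching V A B" by auto
        show "packing (T \<inter> touching V A B)"
          using T by (auto simp: PP_def packing_def intro: pairwise_subset)
        show "covered (T \<inter> touching V A B) \<subseteq> G" using T by (auto simp: PP_def)
        \<comment> \<open>A deleted cross edge lies in a triangle of \<open>T\<close>, and this edge
          puts the triangle into \<open>touching V A B\<close>.\<close>
        show "G \<inter> cross A B \<subseteq> covered (T \<inter> touching V A B)"
          using e T by (fastforce simp: PP_def touching_def)
      qed (use G in auto)
      ultimately show False by simp
    qed
  qed
qed

subsection \<open>Random matchings of interval chromatic number two\<close>

lemma card_Collect_eq_1_iff: "card {x \<in> A. P x} = 1 \<longleftrightarrow> (\<exists>!x. x \<in> A \<and> P x)"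
proof -
  have "card {x \<in> A. P x} = 1 \<longleftrightarrow> (\<exists>a. {x \<in> A. P x} = {a})"
    by (metis card_1_singletonE is_singletonI is_singleton_altdef)
  also have "\<dots> \<longleftrightarrow> (\<exists>!x. x \<in> A \<and> P x)" unfolding set_eq_iff mem_Collect_eq singleton_iff by metis
  finally show ?thesis .
qed

text \<open>Bare edge sets of the perfect matchings between the two halves. Counting takes place
  here, since \<open>matchings_chi2_eq\<close> makes the sample space a copy of this set.\<close>

definition crossing_matchings :: "nat \<Rightarrow> nat set set set" where
  "crossing_matchings k =
     {E. E \<subseteq> cross {1..k} {k+1..2*k} \<and> (\<forall>v\<in>{1..2*k}. \<exists>!e. e \<in> E \<and> v \<in> e)}"

lemma finite_crossing_matchings: "finite (crossing_matchings k)"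
proof -
  have "crossing_matchings k \<subseteq> Pow (cross {1..k} {k+1..2*k})" by (auto simp: crossing_matchings_def)
  moreover have "finite (cross {1..k} {k+1..2*k})" by (simp add: cross_def)
  ultimately show ?thesis by (meson finite_Pow_iff finite_subset)
qed

lemma crossing_matchings_nonempty: "crossing_matchings k \<noteq> {}"
proof -
  have "(\<lambda>i. {i, k + i}) ` {1..k} \<in> crossing_matchings k"
    unfolding crossing_matchings_def mem_Collect_eq
  proof (intro conjI ballI)
    show "(\<lambda>i. {i, k + i}) ` {1..k} \<subseteq> cross {1..k} {k+1..2*k}" by (auto simp: cross_def)
  next
    fix v assume v: "v \<in> {1..2*k}"
    define i where "i = (if v \<le> k then v else v - k)"
    have i: "i \<in> {1..k}" "v \<in> {i, k + i}" using v by (auto simp: i_def)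
    have "j = i" if "j \<in> {1..k}" "v \<in> {j, k + j}" for j using that by (auto simp: i_def)
    then have "e = {i, k + i}" if "e \<in> (\<lambda>i. {i, k + i}) ` {1..k}" "v \<in> e" for e
      using that by (elim imageE) simp
    moreover have "{i, k + i} \<in> (\<lambda>i. {i, k + i}) ` {1..k}" using i(1) by (rule imageI)
    ultimately show "\<exists>!e. e \<in> (\<lambda>i. {i, k + i}) ` {1..k} \<and> v \<in> e" using i(2) by (intro ex1I) auto
  qed
  then show ?thesis by auto
qed

lemma interval_of_initial:
  fixes I :: "nat set"
  assumes "interval_of {1..n} I" "1 \<in> I"
  shows "I = {1..card I}"
proof -
  have I: "I \<subseteq> {1..n}" using assms(1) by (simp add: interval_of_def)
  have int: "z \<in> I" if "x \<in> I" "y \<in> I" "z \<in> {1..n}" "x \<le> z" "z \<le> y" for x y z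
    using assms(1) that unfolding interval_of_def by metis
  have fin: "finite I" using I finite_subset by blast
  have M: "Max I \<in> I" using fin assms(2) by (intro Max_in) auto
  have "I = {1..Max I}"
  proof
    show "I \<subseteq> {1..Max I}" using I fin by auto
    show "{1..Max I} \<subseteq> I" using int[OF assms(2) M] I M by auto
  qed
  then show ?thesis by (metis card_atLeastAtMost diff_Suc_1)
qed

text \<open>Double counting of the incidences between \<open>I\<close> and \<open>E\<close>. It
  forces the two intervals of a partition witnessing interval chromatic number 2 to have equal
  size.\<close>

lemma card_transversal:
  assumes "finite I" "finite E" "\<And>v. v \<in> I \<Longrightarrow> card {e \<in> E. v \<in> e} = 1"
    and "\<And>e. e \<in> E \<Longrightarrow> card (I \<inter> e) = 1"
  shows "card I = card E"
proof -
  have "(\<Sum>v\<in>I. card {e \<in> E. v \<in> e}) = (\<Sum>e\<in>E. 1)"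
    using assms by (intro sum_multicount_gen) (auto simp: Int_def)
  then show ?thesis using assms(3) by simp
qed

text \<open>Every edge has one end in each of the two intervals, so both have as many vertices as
  there are edges, namely \<open>k\<close>, and the interval containing 1 is the lower half.\<close>

lemma edges_cross_if_chi2:
  fixes M :: "nat ograph"
  assumes M: "ordered_matching M" "verts M = {1..2*k}" "interval_chromatic_number M = 2"
  shows "edges M \<subseteq> cross {1..k} {k+1..2*k}"
proof -
  define Q where "Q = (\<lambda>m. \<exists>P. partition_on (verts M) P \<and> card P = m \<and>
        (\<forall>I\<in>P. interval_of (verts M) I \<and> (\<forall>e\<in>edges M. \<not> e \<subseteq> I)))"
  have edge: "e \<subseteq> {1..2*k}" "card e = 2" if "e \<in> edges M" for e
    using that M by (auto simp: ordered_matching_def ordered_graph_def)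
  \<comment> \<open>The partition into singletons shows that the \<open>LEAST\<close> is attained,
    so the value 2 comes with an actual partition.\<close>
  have "Q (card ((\<lambda>v. {v}) ` verts M))"
    unfolding Q_def
  proof (intro exI conjI ballI)
    show "partition_on (verts M) ((\<lambda>v. {v}) ` verts M)"
      by (rule partition_onI) (auto simp: disjnt_def)
  next
    fix I assume "I \<in> (\<lambda>v. {v}) ` verts M"
    then show "interval_of (verts M) I" by (auto simp: interval_of_def)
  next
    fix I e assume "I \<in> (\<lambda>v. {v}) ` verts M" and e: "e \<in> edges M"
    then obtain v where "I = {v}" by auto
    then show "\<not> e \<subseteq> I" using edge(2)[OF e] card_mono[of "{v}" e] by auto
  qed simp
  then have "Q (LEAST m. Q m)" by (rule LeastI)
  then have "Q 2" using M(3) by (simp add: interval_chromatic_number_def Q_def)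
  then obtain P where P: "partition_on {1..2*k} P" "card P = 2"
      "\<And>I. I \<in> P \<Longrightarrow> interval_of {1..2*k} I" "\<And>I e. I \<in> P \<Longrightarrow> e \<in> edges M \<Longrightarrow> \<not> e \<subseteq> I"
    unfolding Q_def M(2) by auto
  obtain I0 J0 where IJ0: "P = {I0, J0}" "I0 \<noteq> J0" using P(2) by (auto simp: card_2_iff)
  have "I0 \<noteq> {}" using partition_onD3[OF P(1)] IJ0 by auto
  moreover have "I0 \<subseteq> {1..2*k}" using partition_onD1[OF P(1)] IJ0 by auto
  ultimately have "1 \<in> {1..2*k}" by auto
  then have "1 \<in> \<Union>P" by (simp only: partition_onD1[OF P(1), symmetric])
  then obtain I J where IJ: "P = {I, J}" "I \<noteq> J" "1 \<in> I" using IJ0 by auto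
  have un: "I \<union> J = {1..2*k}" using partition_onD1[OF P(1)] IJ by auto
  have disj: "I \<inter> J = {}"
    using partition_onD2[OF P(1)] IJ by (auto simp: disjoint_def)
  have fin: "finite I" "finite J" using un by (metis finite_Un finite_atLeastAtMost)+
  have fE: "finite (edges M)"
  proof (rule finite_subset)
    show "edges M \<subseteq> Pow {1..2*k}" using edge(1) by auto
  qed simp
  have split: "\<exists>x y. e = {x, y} \<and> x \<in> I \<and> y \<in> J" if e: "e \<in> edges M" for e
  proof -
    obtain x y where xy: "e = {x, y}" using edge(2)[OF e] by (auto simp: card_2_iff)
    have "\<not> e \<subseteq> I" "\<not> e \<subseteq> J" "e \<subseteq> I \<union> J" using P(4) e IJ edge(1)[OF e] un by auto
    then show ?thesis using xy by (auto simp: insert_commute)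
  qed
  have deg: "card {e \<in> edges M. v \<in> e} = 1" if "v \<in> {1..2*k}" for v
    using that M by (simp add: ordered_matching_def)
  have one: "card (I \<inter> e) = 1 \<and> card (J \<inter> e) = 1" if e: "e \<in> edges M" for e
  proof -
    obtain x y where xy: "e = {x, y}" "x \<in> I" "y \<in> J" using split[OF e] by auto
    then have "I \<inter> e = {x}" "J \<inter> e = {y}" using disj by auto
    then show ?thesis by simp
  qed
  have "card I = card (edges M)" "card J = card (edges M)"
    using fin fE one un by (auto intro!: card_transversal deg)
  moreover have "card I + card J = 2 * k" using card_Un_disjoint[OF fin disj] un by simp
  ultimately have "card I = k" by simp
  moreover have "interval_of {1..2*k} I" using P(3) IJ by auto
  ultimately have I: "I = {1..k}" using interval_of_initial IJ(3) by metis
  have "J = {1..2*k} - I" using un disj by auto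
  then have J: "J = {k+1..2*k}" using I by auto
  show ?thesis
  proof
    fix e assume "e \<in> edges M"
    from split[OF this] show "e \<in> cross {1..k} {k+1..2*k}" unfolding mem_cross_iff I J by blast
  qed
qed

text \<open>The two halves form a valid partition, and a single interval would contain an
  edge.\<close>

lemma chi2_if_edges_cross:
  fixes M :: "nat ograph"
  assumes "0 < k" "edges M \<subseteq> cross {1..k} {k+1..2*k}" "verts M = {1..2*k}" "edges M \<noteq> {}"
  shows "interval_chromatic_number M = 2"
  unfolding interval_chromatic_number_def assms(3)
proof (rule Least_equality)
  show "\<exists>P. partition_on {1..2*k} P \<and> card P = 2 \<and>
     (\<forall>I\<in>P. interval_of {1..2*k} I \<and> (\<forall>e\<in>edges M. \<not> e \<subseteq> I))"
  proof (intro exI conjI ballI)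
    show "partition_on {1..2*k} {{1..k}, {k+1..2*k}}"
      using assms(1) by (intro partition_onI) (auto simp: disjnt_def)
    have "1 \<in> {1..k}" "1 \<notin> {k+1..2*k}" using assms(1) by auto
    then have "{1..k} \<noteq> {k+1..2*k}" by blast
    then show "card {{1..k}, {k+1..2*k}} = 2" by simp
  next
    fix I assume "I \<in> {{1..k}, {k+1..2*k}}"
    then show "interval_of {1..2*k} I" by (auto simp: interval_of_def)
  next
    fix I e assume "I \<in> {{1..k}, {k+1..2*k}}" "e \<in> edges M"
    then show "\<not> e \<subseteq> I" using assms(2) by (fastforce simp: cross_def)
  qed
next
  fix m assume "\<exists>P. partition_on {1..2*k} P \<and> card P = m \<and>
     (\<forall>I\<in>P. interval_of {1..2*k} I \<and> (\<forall>e\<in>edges M. \<not> e \<subseteq> I))"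
  then obtain P where P: "partition_on {1..2*k} P" "card P = m"
    and no: "\<And>I e. I \<in> P \<Longrightarrow> e \<in> edges M \<Longrightarrow> \<not> e \<subseteq> I" by auto
  have fin: "finite P" using P(1) finite_elements by blast
  have un: "\<Union>P = {1..2*k}" using partition_onD1[OF P(1)] by simp
  obtain e where e: "e \<in> edges M" using assms(4) by auto
  have sub: "e \<subseteq> {1..2*k}" using e assms(2) by (auto simp: cross_def)
  show "2 \<le> m"
  proof (rule ccontr)
    assume "\<not> 2 \<le> m"
    then have "card P = 0 \<or> card P = 1" using P(2) by auto
    then show False
    proof
      assume "card P = 0"
      then show False using fin un assms(1) by auto
    next
      assume "card P = 1"
      then obtain I where "P = {I}" by (rule card_1_singletonE)
      then show False using un no[OF _ e] sub by auto
    qed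
  qed
qed

lemma matchings_chi2_eq:
  assumes "0 < k"
  shows "matchings_chi2 (2 * k) = OGraph {1..2*k} ` crossing_matchings k"
proof (intro equalityI subsetI)
  fix M assume M: "M \<in> matchings_chi2 (2 * k)"
  then have M': "ordered_matching M" "verts M = {1..2*k}" "interval_chromatic_number M = 2"
    by (auto simp: matchings_chi2_def)
  have "edges M \<in> crossing_matchings k"
    using edges_cross_if_chi2[OF M'] M'(1,2)
    by (simp add: crossing_matchings_def ordered_matching_def flip: card_Collect_eq_1_iff)
  moreover have "M = OGraph {1..2*k} (edges M)" using M'(2) by (cases M) simp
  ultimately show "M \<in> OGraph {1..2*k} ` crossing_matchings k" by blast
next
  fix M assume "M \<in> OGraph {1..2*k} ` crossing_matchings k"
  then obtain E where M: "M = OGraph {1..2*k} E" and E: "E \<in> crossing_matchings k" by auto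
  have sub: "E \<subseteq> cross {1..k} {k+1..2*k}" and deg: "\<forall>v\<in>{1..2*k}. \<exists>!e. e \<in> E \<and> v \<in> e"
    using E by (auto simp: crossing_matchings_def)
  have "1 \<in> {1..2*k}" using assms by simp
  then have "\<exists>e. e \<in> E" using deg by blast
  then have "interval_chromatic_number M = 2"
    using chi2_if_edges_cross[of k M] sub assms M by auto
  moreover have "ordered_graph M"
    unfolding ordered_graph_def
  proof (intro conjI ballI)
    fix e assume "e \<in> edges M"
    then obtain i j where "i \<in> {1..k}" "j \<in> {k+1..2*k}" "e = {i, j}"
      using sub M by (auto simp: cross_def)
    then show "e \<subseteq> verts M" "card e = 2" using M by auto
  qed (simp add: M)
  moreover have "\<forall>v\<in>{1..2*k}. card {e \<in> E. v \<in> e} = 1"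
    using deg by (simp only: card_Collect_eq_1_iff)
  ultimately show "M \<in> matchings_chi2 (2 * k)"
    using M by (simp add: matchings_chi2_def ordered_matching_def)
qed

section \<open>Switching upper endpoints of crossing matchings\<close>

definition relabel :: "('a \<Rightarrow> 'a) \<Rightarrow> 'a set set \<Rightarrow> 'a set set" where
  "relabel f E = (`) f ` E"

lemma mem_relabel_transpose: "e \<in> relabel (Transposition.transpose x y) E \<longleftrightarrow> Transposition.transpose x y ` e \<in> E"
proof -
  have inv: "Transposition.transpose x y ` Transposition.transpose x y ` e = e" for e by (simp add: image_image)
  show ?thesis
  proof
    show "Transposition.transpose x y ` e \<in> E" if "e \<in> relabel (Transposition.transpose x y) E"
      using that by (auto simp: relabel_def inv)
    show "e \<in> relabel (Transposition.transpose x y) E" if "Transposition.transpose x y ` e \<in> E"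
      unfolding relabel_def using imageI[OF that, of "(`) (Transposition.transpose x y)"] by (simp only: inv)
  qed
qed

lemma relabel_crossing_matchings:
  assumes E: "E \<in> crossing_matchings k" and xy: "x \<in> {k+1..2*k}" "y \<in> {k+1..2*k}"
  shows "relabel (Transposition.transpose x y) E \<in> crossing_matchings k"
proof -
  let ?t = "Transposition.transpose x y"
  have sub: "E \<subseteq> cross {1..k} {k+1..2*k}" and deg: "\<And>v. v \<in> {1..2*k} \<Longrightarrow> \<exists>!e. e \<in> E \<and> v \<in> e"
    using E by (auto simp: crossing_matchings_def)
  have tR: "?t v \<in> {k+1..2*k}" if "v \<in> {k+1..2*k}" for v
    using that xy by (auto simp: Transposition.transpose_def)
  have tL: "?t v = v" if "v \<in> {1..k}" for v using that xy by (auto simp: Transposition.transpose_def)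
  have "relabel ?t E \<subseteq> cross {1..k} {k+1..2*k}"
  proof
    fix e assume "e \<in> relabel ?t E"
    then obtain d where d: "d \<in> E" "e = ?t ` d" by (auto simp: relabel_def)
    then obtain i j where "d = {i, j}" "i \<in> {1..k}" "j \<in> {k+1..2*k}" using sub by (force simp: cross_def)
    then have "e = {i, ?t j}" "i \<in> {1..k}" "?t j \<in> {k+1..2*k}" using d tL tR by auto
    then show "e \<in> cross {1..k} {k+1..2*k}" by (force simp: cross_def)
  qed
  moreover have "\<exists>!e. e \<in> relabel ?t E \<and> v \<in> e" if v: "v \<in> {1..2*k}" for v
  proof -
    have "?t v \<in> {1..2*k}" using v xy by (auto simp: Transposition.transpose_def)
    from deg[OF this] obtain e where e: "e \<in> E" "?t v \<in> e"
      and u: "\<And>d. d \<in> E \<Longrightarrow> ?t v \<in> d \<Longrightarrow> d = e" by auto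
    show ?thesis
    proof (intro ex1I conjI)
      show "?t ` e \<in> relabel ?t E" using e by (simp add: relabel_def)
      show "v \<in> ?t ` e" using e(2) by (metis imageI transpose_involutory)
      fix d assume "d \<in> relabel ?t E \<and> v \<in> d"
      then obtain d' where d': "d' \<in> E" "d = ?t ` d'" "v \<in> ?t ` d'" by (auto simp: relabel_def)
      then have "?t v \<in> d'" by (metis imageE transpose_involutory)
      then show "d = ?t ` e" using u d' by simp
    qed
  qed
  ultimately show ?thesis by (simp add: crossing_matchings_def)
qed

lemma inj_relabel: "inj f \<Longrightarrow> inj (relabel f)"
  unfolding relabel_def by (meson injD injI inj_image_eq_iff inj_on_image_eq_iff inj_image_eq_iff)

definition avoiding :: "nat \<Rightarrow> nat set \<Rightarrow> nat set \<Rightarrow> nat set set set" where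
  "avoiding k I J = {E \<in> crossing_matchings k. E \<inter> cross I J = {}}"

text \<open>Exchanging \<open>y\<close> with some \<open>z \<in> J\<close> maps the matchings with partner \<open>y\<close> of \<open>a\<close> injectively to those
  with partner \<open>z\<close>, so partners in \<open>J\<close> are at least as likely as an average one.\<close>
lemma card_avoiding_insert:
  assumes I: "I \<subseteq> {1..k}" and J: "J \<subseteq> {k+1..2*k}" and a: "a \<in> {1..k}" "a \<notin> I"
  shows "real (card (avoiding k (insert a I) J)) \<le> (1 - real (card J) / k) * real (card (avoiding k I J))"
proof -
  let ?R = "{k+1..2*k}"
  define F where "F = avoiding k I J"
  define C where "C = (\<lambda>y. {E \<in> F. {a, y} \<in> E})"
  have fF: "finite F" by (simp add: F_def avoiding_def finite_crossing_matchings)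
  then have fC: "finite (C y)" for y by (simp add: C_def)
  have fJ: "finite J" using J finite_subset by blast
  have uniq: "d = e" if "E \<in> F" "v \<in> {1..2*k}" "d \<in> E" "e \<in> E" "v \<in> d" "v \<in> e" for E v d e
    using that unfolding F_def avoiding_def crossing_matchings_def by blast
  have disjC: "C y \<inter> C z = {}" if "y \<in> ?R" "z \<in> ?R" "y \<noteq> z" for y z
  proof (rule ccontr)
    assume "C y \<inter> C z \<noteq> {}"
    then obtain E where "E \<in> F" "{a, y} \<in> E" "{a, z} \<in> E" by (auto simp: C_def)
    then have "{a, y} = {a, z}" using uniq[of E a] a by auto
    then show False using that by (auto simp: doubleton_eq_iff)
  qed
  have FC: "F = (\<Union>y\<in>?R. C y)"
  proof
    show "(\<Union>y\<in>?R. C y) \<subseteq> F" by (auto simp: C_def)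
    show "F \<subseteq> (\<Union>y\<in>?R. C y)"
    proof
      fix E assume E: "E \<in> F"
      then have E': "E \<in> crossing_matchings k" by (simp add: F_def avoiding_def)
      then obtain e where e: "e \<in> E" "a \<in> e" using a unfolding crossing_matchings_def by force
      then have "e \<in> cross {1..k} ?R" using E' by (auto simp: crossing_matchings_def)
      then obtain i j where ij: "e = {i, j}" "i \<in> {1..k}" "j \<in> ?R" by (auto simp: cross_def)
      then have "a = i" using e(2) a by auto
      then show "E \<in> (\<Union>y\<in>?R. C y)" using E e ij by (auto simp: C_def)
    qed
  qed
  have sumF: "card F = (\<Sum>y\<in>?R. card (C y))"
    unfolding FC using fC disjC by (intro card_UN_disjoint) auto
  have sumJ: "card (\<Union>y\<in>J. C y) = (\<Sum>y\<in>J. card (C y))"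
    using fC fJ
  proof (intro card_UN_disjoint ballI impI)
    fix y z assume "y \<in> J" "z \<in> J" "y \<noteq> z"
    then show "C y \<inter> C z = {}" using J by (intro disjC) auto
  qed
  \<comment> \<open>Within \<open>F\<close>, the only new requirement is that the partner of
    \<open>a\<close> lies outside \<open>J\<close>.\<close>
  have "avoiding k (insert a I) J = F - (\<Union>y\<in>J. C y)"
    by (auto simp: F_def avoiding_def C_def cross_def)
  moreover have "(\<Union>y\<in>J. C y) \<subseteq> F" by (auto simp: C_def)
  ultimately have card_ins: "real (card (avoiding k (insert a I) J)) = real (card F) - (\<Sum>y\<in>J. real (card (C y)))"
  proof -
    assume diff: "avoiding k (insert a I) J = F - (\<Union>y\<in>J. C y)" and sub: "(\<Union>y\<in>J. C y) \<subseteq> F"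
    have "card (avoiding k (insert a I) J) + card (\<Union>y\<in>J. C y) = card F"
      using diff sub fF by (metis card_Diff_subset card_mono finite_subset le_add_diff_inverse2)
    then have "real (card (avoiding k (insert a I) J)) + real (\<Sum>y\<in>J. card (C y)) = real (card F)"
      unfolding sumJ by (metis of_nat_add)
    then show ?thesis by simp
  qed
  have le: "card (C y) \<le> card (C z)" if y: "y \<in> ?R" and z: "z \<in> J" for y z
  proof (rule card_inj_on_le)
    let ?t = "Transposition.transpose y z"
    show "inj_on (relabel ?t) (C y)" using inj_relabel[OF inj_transpose] by (rule inj_on_subset) auto
    show "relabel ?t ` C y \<subseteq> C z"
    proof
      fix E' assume "E' \<in> relabel ?t ` C y"
      then obtain E where E': "E' = relabel ?t E" and E: "E \<in> F" "{a, y} \<in> E" by (auto simp: C_def)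
      have zR: "z \<in> ?R" using z J by auto
      have "E' \<in> crossing_matchings k"
        using E y zR unfolding E' by (intro relabel_crossing_matchings) (auto simp: F_def avoiding_def)
      moreover have "E' \<inter> cross I J = {}"
      proof (rule ccontr)
        assume "E' \<inter> cross I J \<noteq> {}"
        then obtain i j where ij: "i \<in> I" "j \<in> J" "{i, j} \<in> E'" by (auto simp: cross_def)
        have "?t i = i" using ij(1) I y zR by (auto simp: Transposition.transpose_def)
        then have tij: "{i, ?t j} \<in> E" using ij(3) by (simp add: E' mem_relabel_transpose)
        show False
        proof (cases "?t j \<in> J")
          case True
          then show False using tij E(1) ij(1) by (auto simp: F_def avoiding_def cross_def)
        next
          case False
          \<comment> \<open>The transposition moves an element of \<open>J\<close> out of
            \<open>J\<close> only if it is \<open>z\<close>, sent to \<open>y\<close>. But the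
            partner of \<open>y\<close> in \<open>E\<close> is \<open>a\<close>, which is not in
            \<open>I\<close>.\<close>
          then have "?t j = y" using ij(2) z by (auto simp: Transposition.transpose_def split: if_splits)
          then have "{i, y} = {a, y}" using tij E y uniq[of E y "{i, y}" "{a, y}"] by auto
          then show False using ij(1) a I y by (auto simp: doubleton_eq_iff)
        qed
      qed
      moreover have "{a, z} \<in> E'"
      proof -
        have "?t ` {a, z} = {a, y}" using a y zR by (auto simp: Transposition.transpose_def)
        then show ?thesis using E(2) by (simp add: E' mem_relabel_transpose)
      qed
      ultimately show "E' \<in> C z" by (simp add: C_def F_def avoiding_def)
    qed
  qed (rule fC)
  \<comment> \<open>Averaging: each \<open>C z\<close> with \<open>z\<close> in \<open>J\<close> is
    at least as large as each of the \<open>k\<close> classes \<open>C y\<close>, so together they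
    make up at least the share \<open>card J / k\<close> of \<open>F\<close>.\<close>
  have "real (card J) * real (card F) = (\<Sum>z\<in>J. \<Sum>y\<in>?R. real (card (C y)))"
    by (simp add: sumF)
  also have "\<dots> \<le> (\<Sum>z\<in>J. \<Sum>y\<in>?R. real (card (C z)))"
    using le by (intro sum_mono) auto
  also have "\<dots> = real k * (\<Sum>z\<in>J. real (card (C z)))" by (simp add: sum_distrib_left)
  finally have "real (card J) / k * real (card F) \<le> (\<Sum>z\<in>J. real (card (C z)))"
    using a by (simp add: field_simps)
  then show ?thesis unfolding card_ins by (simp add: algebra_simps flip: F_def)
qed

text \<open>The vertices of \<open>I\<close> are added one at a time. Each step costs the same
  factor, although the partners are not independent.\<close>

lemma card_avoiding_le:
  assumes I: "I \<subseteq> {1..k}" and J: "J \<subseteq> {k+1..2*k}"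
  shows "real (card (avoiding k I J)) \<le> (1 - real (card J) / k) ^ card I * real (card (crossing_matchings k))"
proof -
  have "finite I" using I finite_subset by blast
  then show ?thesis using I
  proof (induction I rule: finite_induct)
    case empty
    then show ?case by (simp add: avoiding_def cross_def)
  next
    case (insert a I)
    have "card J \<le> card {k+1..2*k}" using J by (intro card_mono) auto
    then have "0 \<le> 1 - real (card J) / k" using insert.prems by (simp add: field_simps)
    then have "(1 - real (card J) / k) * real (card (avoiding k I J))
        \<le> (1 - real (card J) / k) * ((1 - real (card J) / k) ^ card I * real (card (crossing_matchings k)))"
      using insert.IH insert.prems by (intro mult_left_mono) auto
    then show ?case
      using card_avoiding_insert[of I k J a] insert.prems insert.hyps J by simp
  qed
qed

text \<open>Intervals of exactly \<open>l\<close> vertices suffice, since a joined pair stays joined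
  when its intervals grow.\<close>

definition intervals_joined :: "nat \<Rightarrow> nat \<Rightarrow> nat set set \<Rightarrow> bool" where
  "intervals_joined k l E \<longleftrightarrow>
     (\<forall>a b. {a..<a+l} \<subseteq> {1..k} \<longrightarrow> {b..<b+l} \<subseteq> {k+1..2*k} \<longrightarrow> E \<inter> cross {a..<a+l} {b..<b+l} \<noteq> {})"

text \<open>Union bound over the starting points of the two intervals, at most \<open>k\<close>
  choices for each.\<close>

lemma card_not_intervals_joined:
  assumes l: "0 < l" "l \<le> k"
  shows "real (card {E \<in> crossing_matchings k. \<not> intervals_joined k l E})
    \<le> (real k)\<^sup>2 * (1 - real l / k) ^ l * real (card (crossing_matchings k))"
proof -
  define Z where "Z = {(a, b). {a..<a+l} \<subseteq> {1..k} \<and> {b..<b+l} \<subseteq> {k+1..2*k}}"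
  let ?A = "\<lambda>z. avoiding k {fst z..<fst z+l} {snd z..<snd z+l}"
  have ZI: "a \<in> {1..k} \<and> b \<in> {k+1..2*k}" if "(a, b) \<in> Z" for a b
    using that l by (auto simp: Z_def subset_iff)
  have Zsub: "Z \<subseteq> {1..k} \<times> {k+1..2*k}" using ZI by auto
  then have fZ: "finite Z" by (rule finite_subset) simp
  have "card Z \<le> card ({1..k} \<times> {k+1..2*k})" using Zsub by (intro card_mono) auto
  then have cZ: "real (card Z) \<le> (real k)\<^sup>2"
    by (simp add: card_cartesian_product power2_eq_square flip: of_nat_mult)
  have "{E \<in> crossing_matchings k. \<not> intervals_joined k l E} \<subseteq> (\<Union>z\<in>Z. ?A z)"
    by (fastforce simp: intervals_joined_def avoiding_def Z_def)
  moreover have fU: "finite (\<Union>z\<in>Z. ?A z)" using fZ by (simp add: avoiding_def finite_crossing_matchings)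
  ultimately have "card {E \<in> crossing_matchings k. \<not> intervals_joined k l E} \<le> card (\<Union>z\<in>Z. ?A z)"
    by (intro card_mono)
  also have "\<dots> \<le> (\<Sum>z\<in>Z. card (?A z))" by (rule card_UN_le[OF fZ])
  finally have "real (card {E \<in> crossing_matchings k. \<not> intervals_joined k l E}) \<le> (\<Sum>z\<in>Z. real (card (?A z)))"
    by (simp flip: of_nat_sum)
  also have "\<dots> \<le> (\<Sum>z\<in>Z. (1 - real l / k) ^ l * real (card (crossing_matchings k)))"
  proof (rule sum_mono)
    fix z assume "z \<in> Z"
    then show "real (card (?A z)) \<le> (1 - real l / k) ^ l * real (card (crossing_matchings k))"
      using card_avoiding_le[of "{fst z..<fst z+l}" k "{snd z..<snd z+l}"] by (auto simp: Z_def)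
  qed
  also have "\<dots> = real (card Z) * ((1 - real l / k) ^ l * real (card (crossing_matchings k)))" by simp
  also have "\<dots> \<le> (real k)\<^sup>2 * ((1 - real l / k) ^ l * real (card (crossing_matchings k)))"
    using cZ l by (intro mult_right_mono) auto
  finally show ?thesis by (simp add: mult.assoc)
qed

subsection \<open>Colouring a blow-up\<close>

text \<open>Every increasing map into a clique is a copy, so the vertices of \<open>G\<close> are
  sent to the elements of \<open>R\<close> of the same rank.\<close>

lemma contains_copy_if_clique:
  fixes G :: "'a::linorder ograph" and H :: "'b::linorder ograph"
  assumes G: "ordered_graph G" and R: "finite R" "R \<subseteq> verts H" "card R = card (verts G)"
    and clique: "\<And>e. e \<subseteq> R \<Longrightarrow> card e = 2 \<Longrightarrow> e \<in> edges H"
  shows "contains_copy H G"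
proof -
  define pos where "pos = (\<lambda>v. card {u \<in> verts G. u < v})"
  define f where "f = (\<lambda>v. sorted_list_of_set R ! pos v)"
  have fin: "finite (verts G)" using G by (simp add: ordered_graph_def)
  have len: "pos v < length (sorted_list_of_set R)" if "v \<in> verts G" for v
  proof -
    have "pos v < card (verts G)" unfolding pos_def using fin that by (intro psubset_card_mono) auto
    then show ?thesis using R by simp
  qed
  have mono: "strict_mono_on (verts G) f"
  proof (rule strict_mono_onI)
    fix u v assume uv: "u \<in> verts G" "v \<in> verts G" "u < v"
    have "pos u < pos v" unfolding pos_def using fin uv by (intro psubset_card_mono) auto
    then show "f u < f v"
      unfolding f_def using len[OF uv(2)] by (intro sorted_wrt_nth_less[OF strict_sorted_list_of_set])
  qed
  have into: "f v \<in> R" if "v \<in> verts G" for v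
    using nth_mem[OF len[OF that]] R(1) by (simp add: f_def)
  have "f ` e \<in> edges H" if "e \<in> edges G" for e
  proof (rule clique)
    have e: "e \<subseteq> verts G" "card e = 2" using G that by (auto simp: ordered_graph_def)
    show "f ` e \<subseteq> R" using into e by auto
    have "inj_on f e" using strict_mono_on_imp_inj_on[OF mono] e(1) by (rule inj_on_subset)
    then show "card (f ` e) = 2" using e(2) by (simp add: card_image)
  qed
  then show ?thesis unfolding contains_copy_def using mono into R(2) by blast
qed

lemma contains_copy_colour_class_mono:
  assumes "contains_copy (colour_class N col c) G" "N \<le> N'"
  shows "contains_copy (colour_class N' col c) G"
proof -
  have "verts (colour_class N col c) \<subseteq> verts (colour_class N' col c)"
    "edges (colour_class N col c) \<subseteq> edges (colour_class N' col c)"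
    using assms(2) by (auto simp: colour_class_def complete_ograph_def subset_iff)
  then show ?thesis using assms(1) unfolding contains_copy_def by blast
qed

lemma ordered_graph_complete_ograph: "ordered_graph (complete_ograph m)"
  by (simp add: ordered_graph_def complete_ograph_def)

text \<open>Ramsey's theorem shows that the \<open>LEAST\<close> is attained. Copies persist when
  \<open>N\<close> grows, so an attained minimum of at most \<open>N\<close> would contradict the
  colouring \<open>col\<close>.\<close>

lemma ordered_ramsey_greater:
  fixes G :: "'a::linorder ograph" and H :: "'b::linorder ograph"
  assumes G: "ordered_graph G" and H: "ordered_graph H"
    and red: "\<not> contains_copy (colour_class N col Red) G"
    and blue: "\<not> contains_copy (colour_class N col Blue) H"
  shows "N < ordered_ramsey G H"
proof -
  define Q where "Q = (\<lambda>N. 0 < N \<and> (\<forall>col. contains_copy (colour_class N col Red) G \<or>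
               contains_copy (colour_class N col Blue) H))"
  \<comment> \<open>Red pairs will be taken as the edges, so cliques are red and independent sets
    are blue.\<close>
  obtain r where r: "r \<ge> 1" and ram: "\<forall>(V :: nat set) E. finite V \<and> card V \<ge> r \<longrightarrow>
      (\<exists>R \<subseteq> V. card R = card (verts G) \<and> clique R E \<or> card R = card (verts H) \<and> indep R E)"
    using ramsey2[of "card (verts G)" "card (verts H)"] by (elim exE conjE)
  have "Q r"
    unfolding Q_def
  proof (intro conjI allI)
    fix col :: "nat set \<Rightarrow> colour"
    obtain R where R: "R \<subseteq> {1..r}"
      "card R = card (verts G) \<and> clique R {e. col e = Red} \<or> card R = card (verts H) \<and> indep R {e. col e = Red}"
      using ram[rule_format, of "{1..r}" "{e. col e = Red}"] by auto
    have fin: "finite R" using R(1) finite_subset by blast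
    from R(2) show "contains_copy (colour_class r col Red) G \<or> contains_copy (colour_class r col Blue) H"
    proof
      assume *: "card R = card (verts G) \<and> clique R {e. col e = Red}"
      have "contains_copy (colour_class r col Red) G"
      proof (rule contains_copy_if_clique[OF G fin])
        fix e assume e: "e \<subseteq> R" "card e = 2"
        then obtain x y where "e = {x, y}" "x \<noteq> y" by (auto simp: card_2_iff)
        then have "col e = Red" using * e by (simp add: clique_def)
        then show "e \<in> edges (colour_class r col Red)"
          using e R(1) by (auto simp: colour_class_def complete_ograph_def)
      qed (use * R(1) in \<open>auto simp: colour_class_def complete_ograph_def\<close>)
      then show ?thesis ..
    next
      assume *: "card R = card (verts H) \<and> indep R {e. col e = Red}"
      have "contains_copy (colour_class r col Blue) H"
      proof (rule contains_copy_if_clique[OF H fin])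
        fix e assume e: "e \<subseteq> R" "card e = 2"
        then obtain x y where "e = {x, y}" "x \<noteq> y" by (auto simp: card_2_iff)
        then have "col e \<noteq> Red" using * e by (simp add: indep_def)
        then have "col e = Blue" by (cases "col e") auto
        then show "e \<in> edges (colour_class r col Blue)"
          using e R(1) by (auto simp: colour_class_def complete_ograph_def)
      qed (use * R(1) in \<open>auto simp: colour_class_def complete_ograph_def\<close>)
      then show ?thesis ..
    qed
  qed (use r in simp)
  then have "Q (LEAST N. Q N)" by (rule LeastI)
  then have "Q (ordered_ramsey G H)" by (simp add: Q_def ordered_ramsey_def)
  then have "contains_copy (colour_class (ordered_ramsey G H) col Red) G \<or>
      contains_copy (colour_class (ordered_ramsey G H) col Blue) H" by (simp add: Q_def)
  then show ?thesis
    using red blue contains_copy_colour_class_mono by (meson not_less)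
qed

text \<open>Fibres with fewer than \<open>l\<close> elements hold at most \<open>r * l\<close>
  elements, at most half of \<open>S\<close>. The remaining half, at least \<open>s * t\<close>
  elements, lies in heavy fibres of at most \<open>t\<close> elements each.\<close>

lemma card_heavy_fibres:
  fixes b :: "'a \<Rightarrow> nat"
  assumes fin: "finite S" and into: "b ` S \<subseteq> {..<r}" and small: "\<And>j. card {x \<in> S. b x = j} \<le> t"
    and l: "2 * r * l \<le> card S" and s: "2 * (s * t) \<le> card S" and t: "0 < t"
  shows "s \<le> card {j \<in> {..<r}. l \<le> card {x \<in> S. b x = j}}"
proof -
  define A where "A = {j \<in> {..<r}. l \<le> card {x \<in> S. b x = j}}"
  have "card S = (\<Sum>j<r. card {x \<in> S. b x = j})"
    using sum.group[OF fin finite_lessThan into, of "\<lambda>_. 1 :: nat"] by simp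
  also have "\<dots> = (\<Sum>j\<in>A. card {x \<in> S. b x = j}) + (\<Sum>j\<in>{..<r} - A. card {x \<in> S. b x = j})"
    by (subst sum.subset_diff[of A]) (auto simp: A_def)
  also have "\<dots> \<le> card A * t + card ({..<r} - A) * l"
  proof (rule add_mono)
    show "(\<Sum>j\<in>A. card {x \<in> S. b x = j}) \<le> card A * t"
      using small sum_bounded_above[of A "\<lambda>j. card {x \<in> S. b x = j}" t] by simp
    have "card {x \<in> S. b x = j} \<le> l" if "j \<in> {..<r} - A" for j using that by (auto simp: A_def)
    then show "(\<Sum>j\<in>{..<r} - A. card {x \<in> S. b x = j}) \<le> card ({..<r} - A) * l"
      using sum_bounded_above[of "{..<r} - A" "\<lambda>j. card {x \<in> S. b x = j}" l] by simp
  qed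
  also have "card ({..<r} - A) * l \<le> r * l"
    using card_mono[of "{..<r}" "{..<r} - A"] by (intro mult_right_mono) auto
  finally have "card S \<le> card A * t + r * l" by simp
  then have "s * t \<le> card A * t" using l s by linarith
  then show ?thesis using t by (simp add: A_def)
qed

lemma convex_contains_interval:
  fixes S :: "nat set"
  assumes fin: "finite S" and l: "0 < l" "l \<le> card S"
    and conv: "\<And>x y z. x \<in> S \<Longrightarrow> y \<in> S \<Longrightarrow> x \<le> z \<Longrightarrow> z \<le> y \<Longrightarrow> z \<in> S"
  obtains a where "{a..<a+l} \<subseteq> S"
proof
  have ne: "S \<noteq> {}" using l by auto
  have "S \<subseteq> {Min S..Max S}" using fin by auto
  then have "card S \<le> card {Min S..Max S}" by (intro card_mono) auto
  then have "Min S + l \<le> Suc (Max S)" using l by simp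
  then show "{Min S..<Min S+l} \<subseteq> S"
    using conv[OF Min_in[OF fin ne] Max_in[OF fin ne]] by auto
qed

text \<open>One block may be heavy for both halves, so \<open>s + 1\<close> heavy blocks per half
  are requested. Discarding the common one leaves the disjoint \<open>s\<close>-sets to which
  \<open>hole\<close> applies.\<close>

lemma ordered_ramsey_blow_up:
  assumes H: "H \<subseteq> nsets {..<r} 2" "\<And>T. T \<in> nsets {..<r} 3 \<Longrightarrow> \<not> nsets T 2 \<subseteq> H"
    and hole: "\<And>A B. A \<subseteq> {..<r} \<Longrightarrow> B \<subseteq> {..<r} \<Longrightarrow> A \<inter> B = {} \<Longrightarrow> card A = s \<Longrightarrow> card B = s \<Longrightarrow> H \<inter> cross A B \<noteq> {}"
    and E: "E \<in> crossing_matchings k" "intervals_joined k l E"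
    and params: "0 < t" "0 < l" "2 * r * l \<le> k" "2 * ((s + 1) * t) \<le> k"
  shows "r * t < ordered_ramsey (OGraph {1..2*k} E) (complete_ograph 3)"
proof -
  \<comment> \<open>Vertices start at 1, so the shift makes the blocks of \<open>{1..r * t}\<close>
    run from \<open>0\<close> to \<open>r - 1\<close>, with \<open>t\<close> vertices each.\<close>
  define block where "block = (\<lambda>x. (x - 1) div t)"
  \<comment> \<open>A pair inside one block has a singleton as image, which is not in
    \<open>H\<close>, so the pair is red.\<close>
  define col where "col = (\<lambda>e. if block ` e \<in> H then Blue else Red)"
  have k: "0 < k" using params by (cases k) auto
  let ?M = "OGraph {1..2*k} E"
  have "?M \<in> matchings_chi2 (2 * k)" unfolding matchings_chi2_eq[OF k] using E(1) by (rule imageI)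
  then have M: "ordered_graph ?M" by (simp add: ordered_matching_def matchings_chi2_def)
  have "\<not> contains_copy (colour_class (r * t) col Blue) (complete_ograph 3)"
  proof
    assume "contains_copy (colour_class (r * t) col Blue) (complete_ograph 3)"
    then obtain f where f: "\<forall>e\<in>edges (complete_ograph 3). f ` e \<in> edges (colour_class (r * t) col Blue)"
      by (auto simp: contains_copy_def)
    have blue: "{block (f i), block (f j)} \<in> H" if "{i, j} \<subseteq> {1..3}" "i \<noteq> j" for i j
    proof -
      have "col (f ` {i, j}) = Blue" using f[rule_format, of "{i, j}"] that by (simp add: colour_class_def complete_ograph_def)
      then show ?thesis by (simp add: col_def split: if_splits)
    qed
    let ?x = "block (f 1)" and ?y = "block (f 2)" and ?z = "block (f 3)"
    have h: "{?x, ?y} \<in> H" "{?y, ?z} \<in> H" "{?x, ?z} \<in> H"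
      using blue[of 1 2] blue[of 2 3] blue[of 1 3] by auto
    \<comment> \<open>Members of \<open>H\<close> are two-element sets, so a blue triangle meets
      three different blocks.\<close>
    then have "?x < r" "?y < r" "?z < r" "?x \<noteq> ?y" "?y \<noteq> ?z" "?x \<noteq> ?z"
      using h[THEN subsetD[OF H(1)]] by simp_all
    then have "{?x, ?y, ?z} \<in> nsets {..<r} 3" by (auto simp: nsets_def)
    moreover have "nsets {?x, ?y, ?z} 2 \<subseteq> H"
      using h by (auto simp: nsets_2_eq insert_commute)
    ultimately show False using H(2) by blast
  qed
  moreover have "\<not> contains_copy (colour_class (r * t) col Red) ?M"
  proof
    assume "contains_copy (colour_class (r * t) col Red) ?M"
    then obtain f where mono: "strict_mono_on {1..2*k} f" and into: "f ` {1..2*k} \<subseteq> {1..r * t}"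
      and red: "\<And>e. e \<in> E \<Longrightarrow> f ` e \<in> edges (colour_class (r * t) col Red)"
      by (auto simp: contains_copy_def colour_class_def complete_ograph_def)
    define b where "b = block \<circ> f"
    have red': "b ` e \<notin> H" if "e \<in> E" for e
      using red[OF that] by (auto simp: colour_class_def col_def b_def image_comp split: if_splits)
    have b_mono: "b x \<le> b y" if "x \<in> {1..2*k}" "y \<in> {1..2*k}" "x \<le> y" for x y
    proof -
      have "f x \<le> f y" using strict_mono_on_leD[OF mono that] .
      then show ?thesis by (simp add: b_def block_def div_le_mono)
    qed
    have b_less: "b x < r" if "x \<in> {1..2*k}" for x
    proof -
      have "f x \<in> {1..r * t}" using into imageI[OF that, of f] by (rule subsetD)
      then have "f x - 1 < r * t" by auto
      then show ?thesis using params(1) by (simp add: b_def block_def less_mult_imp_div_less)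
    qed
    have fibre: "card {x \<in> S. b x = j} \<le> t" if S: "S \<subseteq> {1..2*k}" for S j
    proof -
      have "inj_on f {x \<in> S. b x = j}"
        using strict_mono_on_imp_inj_on[OF mono] S by (auto intro: inj_on_subset)
      moreover have "f ` {x \<in> S. b x = j} \<subseteq> {j * t + 1..j * t + t}"
      proof clarify
        fix x assume x: "x \<in> S" "j = b x"
        have "f x \<in> {1..r * t}" using x(1) S by (intro subsetD[OF into] imageI) auto
        then have "1 \<le> f x" by simp
        moreover have "b x * t \<le> f x - 1" by (simp add: b_def block_def)
        moreover have "f x - 1 < b x * t + t"
          using params(1) dividend_less_div_times[of t "f x - 1"] by (simp add: b_def block_def)
        ultimately show "f x \<in> {b x * t + 1..b x * t + t}" unfolding atLeastAtMost_iff by linarith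
      qed
      ultimately have "card {x \<in> S. b x = j} \<le> card {j * t + 1..j * t + t}"
        by (intro card_inj_on_le) auto
      then show ?thesis by simp
    qed
    have sub: "{1..k} \<subseteq> {1..2*k}" "{k+1..2*k} \<subseteq> {1..2*k}" by auto
    define A where "A = {j \<in> {..<r}. l \<le> card {x \<in> {1..k}. b x = j}}"
    define B where "B = {j \<in> {..<r}. l \<le> card {x \<in> {k+1..2*k}. b x = j}}"
    have cA: "s + 1 \<le> card A"
      unfolding A_def using params b_less sub fibre[OF sub(1)] by (intro card_heavy_fibres[where t = t]) auto
    have cB: "s + 1 \<le> card B"
      unfolding B_def using params b_less sub fibre[OF sub(2)] by (intro card_heavy_fibres[where t = t]) auto
    have fin: "finite A" "finite B" by (auto simp: A_def B_def)
    \<comment> \<open>The lower half is mapped before the upper half, so no block of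
      \<open>A\<close> comes after a block of \<open>B\<close>. Two common blocks would contradict
      this.\<close>
    have "j' \<le> j" if "j \<in> B" "j' \<in> A" for j j'
    proof -
      have "{x \<in> {1..k}. b x = j'} \<noteq> {}" "{x \<in> {k+1..2*k}. b x = j} \<noteq> {}"
        using that params(2) unfolding A_def B_def by (metis (mono_tags, lifting) card.empty mem_Collect_eq not_le)+
      then obtain x y where "x \<in> {1..k}" "b x = j'" "y \<in> {k+1..2*k}" "b y = j" by auto
      then show ?thesis using b_mono[of x y] by auto
    qed
    then have "\<forall>i\<in>A \<inter> B. \<forall>j\<in>A \<inter> B. i = j" by (simp add: le_antisym)
    then have "card (A \<inter> B) \<le> 1" using fin by (simp add: card_le_Suc0_iff_eq)
    then have "s \<le> card (A - B)" using cA card_Diff_subset_Int[of A B] fin by simp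
    then obtain A' where A': "A' \<subseteq> A - B" "card A' = s" by (metis obtain_subset_with_card_n)
    obtain B' where B': "B' \<subseteq> B" "card B' = s" using cB by (metis obtain_subset_with_card_n add_leD1)
    have "H \<inter> cross A' B' \<noteq> {}" using A' B' by (intro hole) (auto simp: A_def B_def)
    then obtain i j where "i \<in> A'" "j \<in> B'" "{i, j} \<in> H" by (auto simp: mem_cross_iff)
    then have ij: "i \<in> A" "j \<in> B" "{i, j} \<in> H" using A'(1) B'(1) by auto
    \<comment> \<open>A fibre of the monotone map \<open>b\<close> within a half is convex, so a
      heavy one contains an interval of length \<open>l\<close>.\<close>
    obtain u where u: "{u..<u+l} \<subseteq> {x \<in> {1..k}. b x = i}"
    proof (rule convex_contains_interval[of "{x \<in> {1..k}. b x = i}" l])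
      fix x y z assume xy: "x \<in> {x \<in> {1..k}. b x = i}" "y \<in> {x \<in> {1..k}. b x = i}" "x \<le> z" "z \<le> y"
      have "b x \<le> b z" using xy by (intro b_mono) auto
      moreover have "b z \<le> b y" using xy by (intro b_mono) auto
      ultimately have "b z = b x" using xy by simp
      then show "z \<in> {x \<in> {1..k}. b x = i}" using xy by auto
    qed (use ij(1) params(2) in \<open>auto simp: A_def\<close>)
    obtain v where v: "{v..<v+l} \<subseteq> {x \<in> {k+1..2*k}. b x = j}"
    proof (rule convex_contains_interval[of "{x \<in> {k+1..2*k}. b x = j}" l])
      fix x y z assume xy: "x \<in> {x \<in> {k+1..2*k}. b x = j}" "y \<in> {x \<in> {k+1..2*k}. b x = j}" "x \<le> z" "z \<le> y"
      have "b x \<le> b z" using xy by (intro b_mono) auto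
      moreover have "b z \<le> b y" using xy by (intro b_mono) auto
      ultimately have "b z = b x" using xy by simp
      then show "z \<in> {x \<in> {k+1..2*k}. b x = j}" using xy by auto
    qed (use ij(2) params(2) in \<open>auto simp: B_def\<close>)
    have "E \<inter> cross {u..<u+l} {v..<v+l} \<noteq> {}"
      using E(2)[unfolded intervals_joined_def, rule_format, OF subset_trans[OF u Collect_restrict]
        subset_trans[OF v Collect_restrict]] .
    then obtain e where "e \<in> E" "e \<in> cross {u..<u+l} {v..<v+l}" by blast
    then obtain x y where xy: "x \<in> {u..<u+l}" "y \<in> {v..<v+l}" "{x, y} \<in> E"
      unfolding mem_cross_iff by blast
    then have "b x = i" "b y = j" using u v by auto
    then show False using red'[OF xy(3)] ij(3) by simp
  qed
  ultimately show ?thesis using ordered_ramsey_greater[OF M ordered_graph_complete_ograph] by blast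
qed

section \<open>Probability bound and choice of parameters\<close>

lemma prob_ordered_ramsey_greater:
  fixes p :: real
  assumes p: "0 < p" "p \<le> 1/2" "16 * real r * p\<^sup>2 \<le> 1"
    and s: "real r ^ (2 * s) * exp (- p * s\<^sup>2 / 2) < 1"
    and params: "0 < t" "0 < l" "0 < r" "2 * r * l \<le> k" "2 * ((s + 1) * t) \<le> k"
  shows "measure_pmf.prob (random_matching_chi2 (2 * k)) {M. r * t < ordered_ramsey M (complete_ograph 3)}
    \<ge> 1 - (real k)\<^sup>2 * (1 - real l / k) ^ l"
proof -
  let ?CM = "crossing_matchings k" and ?MM = "matchings_chi2 (2 * k)"
  let ?big = "{M. r * t < ordered_ramsey M (complete_ograph 3)}"
  have "l \<le> 2 * r * l" using params(3) by (cases r) auto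
  then have "l \<le> k" using params(4) by (rule order_trans)
  then have lk: "l \<le> k" "0 < k" using params(2) by auto
  obtain H where H: "H \<subseteq> nsets {..<r} 2" "\<And>T. T \<in> nsets {..<r} 3 \<Longrightarrow> \<not> nsets T 2 \<subseteq> H"
    "\<And>A B. A \<subseteq> {..<r} \<Longrightarrow> B \<subseteq> {..<r} \<Longrightarrow> A \<inter> B = {} \<Longrightarrow> card A = s \<Longrightarrow> card B = s \<Longrightarrow> H \<inter> cross A B \<noteq> {}"
    using triangle_free_no_hole[of "{..<r}" p s] p s by auto
  have MM: "?MM = OGraph {1..2*k} ` ?CM" using matchings_chi2_eq lk by simp
  have fin: "finite ?MM" "?MM \<noteq> {}"
    using MM finite_crossing_matchings crossing_matchings_nonempty by auto
  have "card ?MM = card ?CM" unfolding MM by (rule card_image) (simp add: inj_on_def)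
  \<comment> \<open>Every matching with joined intervals lies in \<open>?big\<close>, so
    \<open>card_not_intervals_joined\<close> bounds the exceptions.\<close>
  have sub: "?MM - ?big \<subseteq> OGraph {1..2*k} ` {E \<in> ?CM. \<not> intervals_joined k l E}"
    using ordered_ramsey_blow_up[OF H] params unfolding MM by blast
  have fin': "finite {E \<in> ?CM. \<not> intervals_joined k l E}" by (simp add: finite_crossing_matchings)
  have "real (card (?MM - ?big)) \<le> real (card {E \<in> ?CM. \<not> intervals_joined k l E})"
    using card_mono[OF finite_imageI[OF fin'] sub] card_image_le[OF fin', of "OGraph {1..2*k}"] by linarith
  also have "\<dots> \<le> (real k)\<^sup>2 * (1 - real l / k) ^ l * real (card ?MM)"
    using card_not_intervals_joined[OF params(2) lk(1)] \<open>card ?MM = card ?CM\<close> by simp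
  finally have "real (card (?MM - ?big)) / card ?MM \<le> (real k)\<^sup>2 * (1 - real l / k) ^ l"
    using fin by (simp add: divide_le_eq card_gt_0_iff)
  moreover have "measure_pmf.prob (random_matching_chi2 (2 * k)) (- ?big) = real (card (?MM - ?big)) / card ?MM"
    using fin by (simp add: random_matching_chi2_def measure_pmf_of_set Diff_eq)
  moreover have "measure_pmf.prob (random_matching_chi2 (2 * k)) ?big
      = 1 - measure_pmf.prob (random_matching_chi2 (2 * k)) (- ?big)"
    using measure_pmf.prob_compl[of "- ?big" "random_matching_chi2 (2 * k)"] by (simp add: Diff_eq)
  ultimately show ?thesis by simp
qed


text \<open>The inequalities for the choice \<open>r \<approx> sqrt y / 5\<close>, \<open>l \<approx> 2 sqrt (k ln k)\<close>, \<open>s \<approx> 8 y powr (1/4) ln k\<close>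
  and \<open>t \<approx> y powr (3/4) / 20\<close>, with room for the rounding.\<close>
definition admissible :: "nat \<Rightarrow> bool" where
  "admissible k \<longleftrightarrow> (let y = real k / ln (real k) in
     0 < ln (real k) \<and> 1 \<le> y \<and> 2 \<le> ln (real k) \<and> sqrt y / 5 \<ge> 1 \<and>
     2 * (sqrt y / 5) * (2 * sqrt (real k * ln (real k)) + 1) \<le> real k \<and>
     2 * (8 * y powr (1/4) * ln (real k) + 2) * (y powr (3/4) / 20) \<le> real k \<and>
     sqrt y / 5 - 1 \<ge> sqrt y / 6 \<and> y powr (3/4) / 20 - 1 \<ge> y powr (3/4) / 21)"

lemma eventually_admissible: "eventually admissible sequentially"
  unfolding admissible_def Let_def by (intro eventually_conj; real_asymp)

lemma prob_ordered_ramsey_ge: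
  fixes k :: nat
  defines "y \<equiv> real k / ln (real k)"
  assumes adm: "admissible k"
  shows "measure_pmf.prob (random_matching_chi2 (2 * k))
     {M. real (ordered_ramsey M (complete_ograph 3)) \<ge> y powr (5/4) / 126} \<ge> 1 - 1 / real k"
proof -
  have ev: "0 < ln (real k)" "sqrt y / 5 \<ge> 1"
     "2 * (sqrt y / 5) * (2 * sqrt (real k * ln (real k)) + 1) \<le> real k"
     "2 * (8 * y powr (1/4) * ln (real k) + 2) * (y powr (3/4) / 20) \<le> real k"
     "sqrt y / 5 - 1 \<ge> sqrt y / 6" "y powr (3/4) / 20 - 1 \<ge> y powr (3/4) / 21"
     "2 \<le> ln (real k)" "y \<ge> 1"
    using adm unfolding admissible_def Let_def y_def by simp_all
  define l where "l = nat \<lceil>2 * sqrt (real k * ln (real k))\<rceil>"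
  define r where "r = nat \<lfloor>sqrt y / 5\<rfloor>"
  define s where "s = nat \<lceil>8 * y powr (1/4) * ln (real k)\<rceil>"
  define t where "t = nat \<lfloor>y powr (3/4) / 20\<rfloor>"
  \<comment> \<open>The largest \<open>p\<close> with
    \<open>16 * real r * p\<^sup>2 \<le> 1\<close>.\<close>
  define p where "p = 1 / (4 * sqrt (real r))"
  have k: "1 < k" using ev(1) by (cases "k = 0 \<or> k = 1") auto
  have r: "real r \<le> sqrt y / 5" "real r \<ge> sqrt y / 6" "1 \<le> r"
    using ev(2,5) unfolding r_def by linarith+
  have t: "real t \<le> y powr (3/4) / 20" "real t \<ge> y powr (3/4) / 21"
    using ev(6) by (simp_all add: t_def) linarith+
  have "0 < y powr (3/4)" using ev(8) by simp
  then have t0: "0 < t" using t(2) by (cases "t = 0") auto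
  have sq: "0 < sqrt (real k * ln (real k))" using k ev(1) by simp
  have l: "real l \<le> 2 * sqrt (real k * ln (real k)) + 1" "real l \<ge> 2 * sqrt (real k * ln (real k))"
    using sq unfolding l_def by linarith+
  have l0: "0 < l" using l(2) sq by (cases "l = 0") auto
  have spos: "0 < 8 * y powr (1/4) * ln (real k)" using ev by simp
  have s: "real s \<le> 8 * y powr (1/4) * ln (real k) + 1" "real s \<ge> 8 * y powr (1/4) * ln (real k)"
    using spos unfolding s_def by linarith+
  have "real (2 * r * l) \<le> 2 * (sqrt y / 5) * (2 * sqrt (real k * ln (real k)) + 1)"
    unfolding of_nat_mult using r(1) l(1) ev(2,8) by (intro mult_mono) auto
  then have rl: "2 * r * l \<le> k" using ev(3) by linarith
  have "real (2 * ((s + 1) * t)) = 2 * (real s + 1) * real t" by (simp add: algebra_simps)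
  also have "\<dots> \<le> 2 * (8 * y powr (1/4) * ln (real k) + 2) * (y powr (3/4) / 20)"
    using s(1) t(1) spos by (intro mult_mono) auto
  finally have st: "2 * ((s + 1) * t) \<le> k" using ev(4) by linarith
  have p: "0 < p" "p \<le> 1/2" "16 * real r * p\<^sup>2 \<le> 1"
  proof -
    have "1 \<le> sqrt (real r)" using r(3) by simp
    then have "2 \<le> 4 * sqrt (real r)" by linarith
    then show "p \<le> 1/2" unfolding p_def by (intro frac_le) linarith+
    show "0 < p" "16 * real r * p\<^sup>2 \<le> 1"
      using r(3) by (auto simp: p_def field_simps power2_eq_square)
  qed
  have yk: "y \<le> real k" using ev(7) k unfolding y_def by (simp add: field_simps)
  have "sqrt (real r) \<le> sqrt (sqrt y / 4)" using r(1) ev(8) by simp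
  also have "\<dots> = y powr (1/4) / 2"
    using ev(8) by (simp add: real_sqrt_divide powr_half_sqrt[symmetric] powr_powr)
  finally have sr: "sqrt (real r) \<le> y powr (1/4) / 2" .
  have s0: "0 < s" using s(2) spos by (cases "s = 0") auto
  have lnr2: "2 * ln (real r) < ln (real k)"
  proof -
    have "(real r)\<^sup>2 \<le> (sqrt y / 5)\<^sup>2" using r(1) by (intro power_mono) auto
    also have "\<dots> < real k" using ev(8) yk by (simp add: power_divide)
    finally have "ln ((real r)\<^sup>2) < ln (real k)" using r(3) by (subst ln_less_cancel_iff) auto
    then show ?thesis using r(3) by (simp add: ln_realpow)
  qed
  \<comment> \<open>The target \<open>4 * ln r < p * s\<close> is the comparison of exponents behind
    \<open>small\<close>, divided by \<open>s / 2\<close>.\<close>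
  have "4 * ln (real r) < 2 * ln (real k)" using lnr2 by linarith
  also have "\<dots> \<le> p * real s"
  proof -
    have "2 * ln (real k) * (4 * sqrt (real r)) \<le> 2 * ln (real k) * (4 * (y powr (1/4) / 2))"
      using sr ev(1) by (intro mult_left_mono) auto
    also have "\<dots> \<le> real s" using s(2) spos by (simp add: algebra_simps)
    finally show ?thesis using r(3) by (simp add: p_def field_simps)
  qed
  finally have "real s * (4 * ln (real r)) < real s * (p * real s)" using s0 by simp
  then have "p * s\<^sup>2 / 2 > 2 * s * ln (real r)" by (simp add: power2_eq_square algebra_simps)
  then have small: "real r ^ (2 * s) * exp (- p * s\<^sup>2 / 2) < 1"
  proof -
    have "real r ^ (2 * s) = exp (2 * s * ln (real r))"
      using r(3) by (simp add: exp_of_nat_mult flip: powr_realpow) (simp add: powr_def)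
    then show ?thesis using \<open>p * s\<^sup>2 / 2 > 2 * s * ln (real r)\<close> by (simp flip: exp_add)
  qed
  have "1 - (real k)\<^sup>2 * (1 - real l / k) ^ l
     \<le> measure_pmf.prob (random_matching_chi2 (2 * k)) {M. r * t < ordered_ramsey M (complete_ograph 3)}"
    using prob_ordered_ramsey_greater[OF p small t0 l0 _ rl st] r(3) by simp
  also have "\<dots> \<le> measure_pmf.prob (random_matching_chi2 (2 * k))
     {M. real (ordered_ramsey M (complete_ograph 3)) \<ge> y powr (5/4) / 126}"
  proof (rule measure_pmf.finite_measure_mono)
    \<comment> \<open>The constants 6 and 21 absorb the rounding of \<open>r\<close> and
      \<open>t\<close>, and \<open>1/2 + 3/4 = 5/4\<close>.\<close>
    have "y powr (5/4) / 126 = (sqrt y / 6) * (y powr (3/4) / 21)"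
      using ev(8) by (simp add: powr_half_sqrt[symmetric] flip: powr_add)
    also have "\<dots> \<le> real r * real t" using r(2) t(2) ev(8) by (intro mult_mono) auto
    finally have rt: "y powr (5/4) / 126 \<le> real (r * t)" by simp
    show "{M :: nat ograph. r * t < ordered_ramsey M (complete_ograph 3)}
        \<subseteq> {M. real (ordered_ramsey M (complete_ograph 3)) \<ge> y powr (5/4) / 126}"
    proof
      fix M :: "nat ograph" assume "M \<in> {M. r * t < ordered_ramsey M (complete_ograph 3)}"
      then have "real (r * t) \<le> real (ordered_ramsey M (complete_ograph 3))" by (intro of_nat_mono) simp
      then show "M \<in> {M. real (ordered_ramsey M (complete_ograph 3)) \<ge> y powr (5/4) / 126}"
        unfolding mem_Collect_eq using rt by linarith
    qed
  qed simp
  finally have main: "1 - (real k)\<^sup>2 * (1 - real l / k) ^ l \<le> measure_pmf.prob (random_matching_chi2 (2 * k))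
     {M. real (ordered_ramsey M (complete_ograph 3)) \<ge> y powr (5/4) / 126}" .
  have "l \<le> 2 * r * l" using r(3) by (cases r) auto
  then have "l \<le> k" using rl by (rule order_trans)
  then have "(1 - real l / k) ^ l \<le> exp (- (real l / k)) ^ l"
    using exp_ge_add_one_self[of "- (real l / k)"] k by (intro power_mono) (auto simp: field_simps)
  also have "\<dots> = exp (- (real l * real l / k))" by (simp flip: exp_of_nat_mult)
  \<comment> \<open>The choice of \<open>l\<close> gives \<open>l * l / k \<ge> 4 * ln k\<close>.
    The resulting \<open>1 / k ^ 4\<close> outweighs the factor \<open>k\<^sup>2\<close> from the
    choice of the two intervals.\<close>
  also have "\<dots> \<le> exp (- (4 * ln (real k)))"
  proof -
    have "(2 * sqrt (real k * ln (real k))) * (2 * sqrt (real k * ln (real k))) \<le> real l * real l"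
      using l(2) sq by (intro mult_mono) auto
    then have "4 * (real k * ln (real k)) \<le> real l * real l" using ev(1) by simp
    then show ?thesis using k by (simp add: field_simps)
  qed
  also have "\<dots> = 1 / real k ^ 4"
  proof -
    have "exp (4 * ln (real k)) = real k ^ 4" using k exp_of_nat_mult[of 4 "ln (real k)"] by simp
    then show ?thesis by (simp add: exp_minus field_simps)
  qed
  finally have "(real k)\<^sup>2 * (1 - real l / k) ^ l \<le> (real k)\<^sup>2 * (1 / real k ^ 4)"
    by (intro mult_left_mono) auto
  also have "\<dots> = 1 / (real k * real k)" using k by (simp add: field_simps eval_nat_numeral)
  also have "\<dots> \<le> 1 / real k" using k by (simp add: field_simps)
  finally show ?thesis using main by linarith
qed

theorem theorem2:
  "\<exists>c::real. c > 0 \<and>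
     ((\<lambda>n::nat. measure_pmf.prob (random_matching_chi2 n)
         {M. real (ordered_ramsey M (complete_ograph 3))
               \<ge> c * (real n / log 2 (real n)) powr (5/4)})
       \<longlongrightarrow> 1) (inf sequentially (principal {n. even n \<and> 0 < n}))"
proof (intro exI conjI)
  let ?F = "inf sequentially (principal {n. even n \<and> 0 < n})"
  let ?P = "\<lambda>n. measure_pmf.prob (random_matching_chi2 n)
         {M. real (ordered_ramsey M (complete_ograph 3))
               \<ge> 1/504 * (real n / log 2 (real n)) powr (5/4)}"
  obtain K where K: "\<And>k. k \<ge> K \<Longrightarrow> admissible k"
    using eventually_admissible unfolding eventually_sequentially by blast
  have lower: "1 - 2 / real n \<le> ?P n" if n: "n \<ge> 2 * K" "even n" for n
  proof -
    obtain k where k: "n = 2 * k" using n(2) by (rule evenE)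
    define y where "y = real k / ln (real k)"
    have adm: "admissible k" using K[of k] n(1) k by simp
    then have ev: "0 < ln (real k)" "1 \<le> y" by (simp_all add: admissible_def Let_def y_def)
    have k0: "1 < k" using ev(1) by (cases "k = 0 \<or> k = 1") auto
    have "1 - 2 / real n = 1 - 1 / real k" using k k0 by simp
    also have "\<dots> \<le> measure_pmf.prob (random_matching_chi2 (2 * k))
       {M. real (ordered_ramsey M (complete_ograph 3)) \<ge> y powr (5/4) / 126}"
      unfolding y_def by (rule prob_ordered_ramsey_ge[OF adm])
    also have "\<dots> \<le> ?P n"
      unfolding k
    proof (rule measure_pmf.finite_measure_mono)
      \<comment> \<open>Passing to \<open>n = 2 * k\<close> and base 2 at most doubles
        \<open>y\<close>, and \<open>2 powr (5/4) \<le> 4\<close> accounts for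
        \<open>504 = 4 * 126\<close>.\<close>
      have ln2: "ln (real (2 * k)) \<ge> ln (real k)" "ln 2 \<le> (1::real)" "0 < ln (2::real)"
        using k0 ln_2_less_1 by auto
      have "real (2 * k) / log 2 (real (2 * k)) = 2 * real k * ln 2 / ln (real (2 * k))"
        by (simp add: log_def)
      also have "\<dots> \<le> 2 * real k * 1 / ln (real k)"
        using ln2 ev(1) by (intro frac_le mult_mono) auto
      finally have "real (2 * k) / log 2 (real (2 * k)) \<le> 2 * y" by (simp add: y_def)
      moreover have "0 \<le> real (2 * k) / log 2 (real (2 * k))" using k0 by simp
      ultimately have "(real (2 * k) / log 2 (real (2 * k))) powr (5/4) \<le> (2 * y) powr (5/4)"
        by (intro powr_mono2) auto
      also have "\<dots> = 2 powr (5/4) * y powr (5/4)" using ev(2) by (simp add: powr_mult)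
      also have "\<dots> \<le> 2 powr 2 * y powr (5/4)"
        by (intro mult_right_mono powr_mono) auto
      finally have "1/504 * (real (2 * k) / log 2 (real (2 * k))) powr (5/4) \<le> y powr (5/4) / 126" by simp
      then show "{M :: nat ograph. real (ordered_ramsey M (complete_ograph 3)) \<ge> y powr (5/4) / 126}
         \<subseteq> {M. real (ordered_ramsey M (complete_ograph 3))
               \<ge> 1/504 * (real (2 * k) / log 2 (real (2 * k))) powr (5/4)}"
        by auto
    qed simp
    finally show ?thesis .
  qed
  show "(?P \<longlongrightarrow> 1) ?F"
  proof (rule tendsto_sandwich)
    \<comment> \<open>For odd \<open>n\<close> the sample space is empty and the distribution
      unspecified; the filter asks for the bound at even \<open>n\<close> only.\<close>
    show "eventually (\<lambda>n. 1 - 2 / real n \<le> ?P n) ?F"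
      unfolding eventually_inf_principal using eventually_ge_at_top[of "2 * K"]
      by eventually_elim (use lower in auto)
    show "eventually (\<lambda>n. ?P n \<le> 1) ?F" by (simp add: measure_pmf.prob_le_1)
    have "((\<lambda>n. 1 - 2 / real n) \<longlongrightarrow> 1) sequentially" by real_asymp
    then show "((\<lambda>n. 1 - 2 / real n) \<longlongrightarrow> 1) ?F" by (rule tendsto_mono[OF inf_le1])
  qed simp
qed simp

end
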